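(* Let $0<\gamma<1$, $\alpha\in\mathbb{R}$, and let $\mathcal D^{\mathsf s}_\gamma(\Delta_T^3;B_\alpha)$ be a subcritical admissible selection domain for a linear splitting rule $\mathsf s$. Then the dyadic recursion, which assigns to $H$ the selected residual $R^{\mathsf s}(H)$ on dyadic pairs, extends uniquely by continuity to a continuous linear map $$\hat\Lambda^{\mathsf s}_{S,\gamma,\alpha}:\mathcal D^{\mathsf s}_\gamma(\Delta_T^3;B_\alpha)\to C^{\gamma}(\Delta_T^2;B_\alpha),\qquad H\mapsto\hat\Lambda^{\mathsf s}_{S,\gamma,\alpha}H:=R^{\mathsf s}(H),$$ satisfying $\hat\delta\hat\Lambda^{\mathsf s}_{S,\gamma,\alpha}H=H$. Moreover, $$\|\hat\Lambda^{\mathsf s}_{S,\gamma,\alpha}H\|_{\gamma,\alpha}\le C_{\gamma,\theta,T,S,\mathsf s}\|H\|_{\gamma,\alpha}.$$ For an individual defect $H\in Z\hat C^\gamma(\Delta_T^3;B_\alpha)$ outside a fixed linear domain (with a subcritical admissible splitting rule with constants $\theta$, $C_H$, and satisfying the residual continuity criterion), the same estimate holds with the right-hand side replaced by $C_{\gamma,\theta,T,S}(\|H\|_{\gamma,\alpha}+C_H)$.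
   Context: Fix $T>0$. $(B_\alpha)_{\alpha\in\mathbb{R}}$ is a Banach scale, i.e. a family of Banach spaces such that for $\alpha\le\beta$ the embedding $B_\beta\hookrightarrow B_\alpha$ is continuous. $S=(S_t)_{t\ge0}$ is an analytic (in particular strongly continuous) semigroup of bounded linear operators acting on this scale, with $S_0=\mathrm{Id}$; for every $\alpha\in\mathbb{R}$, $\varepsilon\in(0,1)$ there is $C_{\alpha,\varepsilon,T}>0$ with $\|S_tx\|_{B_{\alpha+\varepsilon}}\le C_{\alpha,\varepsilon,T}t^{-\varepsilon}\|x\|_{B_\alpha}$ and $\|(S_t-\mathrm{Id})x\|_{B_\alpha}\le C_{\alpha,\varepsilon,T}t^{\varepsilon}\|x\|_{B_{\alpha+\varepsilon}}$ for all $t\in(0,T]$. $\Delta_T^n:=\{(t_1,\dots,t_n)\in[0,T]^n:0\le t_n\le\dots\le t_1\le T\}$; $C(\Delta_T^n;B_\alpha)$ denotes continuous maps; $(\hat\delta g)_{t_1\dots t_{n+1}}:=\sum_{i=1}^{n+1}(-1)^ig_{t_1\dots\hat t_i\dots t_{n+1}}-(S_{t_1-t_2}-\mathrm{Id})g_{t_2\dots t_{n+1}}$; in particular $(\hat\delta g)_{tus}=g_{ts}-g_{tu}-S_{t-u}g_{us}$ for two-increments. $\|g\|_{\gamma,\alpha}:=\sup_{s<t}\|g_{ts}\|_{B_\alpha}/|t-s|^\gamma$ for $g\in C(\Delta_T^2;B_\alpha)$; $\|h\|_{\gamma,\alpha}:=\inf\{\sum_{j=1}^m\sup_{s<u<t}\frac{\|h_{j,tus}\|_{B_\alpha}}{|t-u|^{\rho_j}|u-s|^{\gamma-\rho_j}}:h=\sum_{j=1}^mh_j,\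 m\in\mathbb{N},\ 0<\rho_j<\gamma\}$ for $h\in C(\Delta_T^3;B_\alpha)$; $C^\gamma(\Delta_T^2;B_\alpha)$, $C^\gamma(\Delta_T^3;B_\alpha)$ are the sets of finite norm; $Z\hat C^\gamma(\Delta_T^3;B_\alpha):=\ker\hat\delta\cap C^\gamma(\Delta_T^3;B_\alpha)$. Dyadic recursion. Let $\mathcal D_n:=\{kT2^{-n}:0\le k\le2^n\}$, $\mathcal D:=\bigcup_{n\ge0}\mathcal D_n$; a dyadic interval is an interval between consecutive points of some $\mathcal D_n$. For $H\in Z\hat C^\gamma(\Delta_T^3;B_\alpha)$ let $B^H_{ts}:=-H_{ts0}$. A (defect-dependent scale) splitting rule $\mathsf s$ for $H$ assigns to each dyadic interval $[a,c]$ with midpoint $b=(a+c)/2$ carrying a residual $Q_{ca}\in B_\alpha$ generated by the recursion two child residuals $Q^{\mathsf s}_{cb},Q^{\mathsf s}_{ba}\in B_\alpha$ with $$Q_{ca}=Q^{\mathsf s}_{cb}+S_{c-b}Q^{\mathsf s}_{ba}+H_{cba}.\qquad(\ast)$$ The recursion constructs a path $I^{\mathsf s}=I^{\mathsf s}(H):\mathcal D\to B_\alpha$, with $R^{\mathsf s}_{ts}:=B^H_{ts}-I^{\mathsf s}_t+S_{t-s}I^{\mathsf s}_s$ for $s\le t$ in $\mathcal D$: set $I^{\mathsf s}_0:=0$, $I^{\mathsf s}_T:=B^H_{T0}$; once $I^{\mathsf s}$ is defined at the endpoints of a dyadic interval $[a,c]$ with midpoint $b$, put $Q_{ca}:=R^{\mathsf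 s}_{ca}$, apply $\mathsf s$ to get $Q^{\mathsf s}_{cb},Q^{\mathsf s}_{ba}$, and set $I^{\mathsf s}_b:=B^H_{ba}+S_{b-a}I^{\mathsf s}_a-Q^{\mathsf s}_{ba}$. The rule is subcritical admissible for $H$ if there are $0\le\theta<2^{-\gamma}$ and $C_H\ge0$ such that for every generated residual $Q_{ca}$ on a dyadic interval of length $L=c-a$, $\max\{\|Q^{\mathsf s}_{cb}\|_{B_\alpha},\|Q^{\mathsf s}_{ba}\|_{B_\alpha}\}\le\theta\|Q_{ca}\|_{B_\alpha}+C_HL^\gamma$. Residual continuity criterion: $\lim_{h\downarrow0}\sup\{\|(S_h-\mathrm{Id})R^{\mathsf s}_{ts}\|_{B_\alpha}:s\le t,\ s,t\in\mathcal D,\ t+h\le T\}=0$. Subcritical admissible selection domain (for a fixed linear splitting rule $\mathsf s$, i.e. one for which the generated residuals depend linearly on $H$): a linear subspace $\mathcal D^{\mathsf s}_\gamma(\Delta_T^3;B_\alpha)\subset Z\hat C^\gamma(\Delta_T^3;B_\alpha)$ such that for every $H$ in it the recursion is well defined, $(\ast)$ holds at each step, the subcritical admissibility estimate holds with a fixed $\theta<2^{-\gamma}$ and $C_H\le C_{\mathsf s}\|H\|_{\gamma,\alpha}$ (with $C_{\mathsf s}$ independent of $H$), and the residual continuity criterion holds. *)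

theory Defs
  imports "HOL-Analysis.Analysis"
begin

text \<open>
  The spaces of a scale live inside one ambient real vector space: a member is given by its
  underlying linear subspace together with its norm, and the embeddings are inclusions.
\<close>

definition banach_space_on :: "'a::real_vector set \<Rightarrow> ('a \<Rightarrow> real) \<Rightarrow> bool" where
  "banach_space_on B nrm \<longleftrightarrow>
     subspace B \<and>
     (\<forall>x\<in>B. 0 \<le> nrm x \<and> (nrm x = 0 \<longleftrightarrow> x = 0)) \<and>
     (\<forall>x\<in>B. \<forall>y\<in>B. nrm (x + y) \<le> nrm x + nrm y) \<and>
     (\<forall>x\<in>B. \<forall>c. nrm (c *\<^sub>R x) = \<bar>c\<bar> * nrm x) \<and>
     (\<forall>u. (\<forall>n::nat. u n \<in> B) \<longrightarrow> (\<forall>e>0. \<exists>M. \<forall>m\<ge>M. \<forall>n\<ge>M. nrm (u m - u n) < e) \<longrightarrow>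
        (\<exists>x\<in>B. (\<lambda>n. nrm (u n - x)) \<longlonglongrightarrow> 0))"

definition banach_scale :: "(real \<Rightarrow> 'a::real_vector set) \<Rightarrow> (real \<Rightarrow> 'a \<Rightarrow> real) \<Rightarrow> bool" where
  "banach_scale B nrm \<longleftrightarrow>
     (\<forall>\<alpha>. banach_space_on (B \<alpha>) (nrm \<alpha>)) \<and>
     (\<forall>\<alpha> \<beta>. \<alpha> \<le> \<beta> \<longrightarrow> B \<beta> \<subseteq> B \<alpha> \<and> (\<exists>C. \<forall>x\<in>B \<beta>. nrm \<alpha> x \<le> C * nrm \<beta> x))"

definition bounded_operator_on :: "'a::real_vector set \<Rightarrow> ('a \<Rightarrow> real) \<Rightarrow> ('a \<Rightarrow> 'a) \<Rightarrow> bool" where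
  "bounded_operator_on B nrm L \<longleftrightarrow>
     (\<forall>x\<in>B. L x \<in> B) \<and>
     (\<forall>x\<in>B. \<forall>y\<in>B. \<forall>a b. L (a *\<^sub>R x + b *\<^sub>R y) = a *\<^sub>R L x + b *\<^sub>R L y) \<and>
     (\<exists>C. \<forall>x\<in>B. nrm (L x) \<le> C * nrm x)"

definition strongly_continuous_semigroup_on ::
    "'a::real_vector set \<Rightarrow> ('a \<Rightarrow> real) \<Rightarrow> (real \<Rightarrow> 'a \<Rightarrow> 'a) \<Rightarrow> bool" where
  "strongly_continuous_semigroup_on B nrm S \<longleftrightarrow>
     (\<forall>t\<ge>0. bounded_operator_on B nrm (S t)) \<and>
     (\<forall>x\<in>B. S 0 x = x) \<and>
     (\<forall>s\<ge>0. \<forall>t\<ge>0. \<forall>x\<in>B. S (s + t) x = S s (S t x)) \<and>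
     (\<forall>x\<in>B. \<forall>t\<ge>0. ((\<lambda>r. nrm (S r x - S t x)) \<longlongrightarrow> 0) (at t within {0..}))"

text \<open>
  Analyticity means a holomorphic extension to a sector around the positive half-line. As the
  scalars are real, it is expressed on the complexification: the pair (x, y) stands for x + iy. The
  sum norm used there is equivalent to the usual complexification norms, and pointwise holomorphy
  is equivalent to holomorphy in operator norm. If the spaces happen to be complex and the semigroup
  complex linear, this is equivalent to analyticity in the original complex structure.
\<close>

definition cscale :: "complex \<Rightarrow> 'a::real_vector \<times> 'a \<Rightarrow> 'a \<times> 'a" where
  "cscale z p = (Re z *\<^sub>R fst p - Im z *\<^sub>R snd p, Im z *\<^sub>R fst p + Re z *\<^sub>R snd p)"

definition cnorm :: "('a \<Rightarrow> real) \<Rightarrow> 'a \<times> 'a \<Rightarrow> real" where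
  "cnorm nrm p = nrm (fst p) + nrm (snd p)"

definition sector :: "real \<Rightarrow> complex set" where
  "sector \<phi> = {rcis r a | r a. 0 < r \<and> \<bar>a\<bar> < \<phi>}"

definition analytic_semigroup_on ::
    "'a::real_vector set \<Rightarrow> ('a \<Rightarrow> real) \<Rightarrow> (real \<Rightarrow> 'a \<Rightarrow> 'a) \<Rightarrow> bool" where
  "analytic_semigroup_on B nrm S \<longleftrightarrow>
     strongly_continuous_semigroup_on B nrm S \<and>
     (\<exists>\<phi> U. 0 < \<phi> \<and> \<phi> \<le> pi / 2 \<and>
        (\<forall>t\<ge>0. \<forall>x\<in>B. \<forall>y\<in>B. U (complex_of_real t) (x, y) = (S t x, S t y)) \<and>
        (\<forall>z\<in>insert 0 (sector \<phi>).
           (\<forall>p\<in>B \<times> B. U z p \<in> B \<times> B) \<and>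
           (\<forall>p\<in>B \<times> B. \<forall>q\<in>B \<times> B. \<forall>v w.
              U z (cscale v p + cscale w q) = cscale v (U z p) + cscale w (U z q)) \<and>
           (\<exists>C. \<forall>p\<in>B \<times> B. cnorm nrm (U z p) \<le> C * cnorm nrm p)) \<and>
        (\<forall>z\<in>insert 0 (sector \<phi>). \<forall>w\<in>insert 0 (sector \<phi>). \<forall>p\<in>B \<times> B.
           U (z + w) p = U z (U w p)) \<and>
        (\<forall>p\<in>B \<times> B. \<forall>z\<in>sector \<phi>. \<exists>d\<in>B \<times> B.
           ((\<lambda>h. cnorm nrm (cscale (1 / h) (U (z + h) p - U z p) - d)) \<longlongrightarrow> 0) (at 0)) \<and>
        (\<forall>p\<in>B \<times> B. ((\<lambda>z. cnorm nrm (U z p - p)) \<longlongrightarrow> 0) (at 0 within sector \<phi>)))"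

definition analytic_semigroup_on_scale ::
    "real \<Rightarrow> (real \<Rightarrow> 'a::real_vector set) \<Rightarrow> (real \<Rightarrow> 'a \<Rightarrow> real) \<Rightarrow> (real \<Rightarrow> 'a \<Rightarrow> 'a) \<Rightarrow> bool" where
  "analytic_semigroup_on_scale T B nrm S \<longleftrightarrow>
     (\<forall>\<alpha>. analytic_semigroup_on (B \<alpha>) (nrm \<alpha>) S) \<and>
     (\<forall>\<alpha> \<epsilon>. 0 < \<epsilon> \<and> \<epsilon> < 1 \<longrightarrow>
        (\<exists>C>0. \<forall>t. 0 < t \<and> t \<le> T \<longrightarrow>
           (\<forall>x\<in>B \<alpha>. S t x \<in> B (\<alpha> + \<epsilon>) \<and> nrm (\<alpha> + \<epsilon>) (S t x) \<le> C * t powr (-\<epsilon>) * nrm \<alpha> x) \<and>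
           (\<forall>x\<in>B (\<alpha> + \<epsilon>). nrm \<alpha> (S t x - x) \<le> C * t powr \<epsilon> * nrm (\<alpha> + \<epsilon>) x)))"


section \<open>Increments\<close>

text \<open>
  An n-increment is a function on lists of length n, so that g [t, s] is the value at s \<le> t. In all
  definitions below B and nrm denote one fixed space of the scale and its norm.
\<close>

definition simplex_T :: "real \<Rightarrow> nat \<Rightarrow> real list set" where
  "simplex_T T n = {ts. length ts = n \<and> set ts \<subseteq> {0..T} \<and> sorted_wrt (\<ge>) ts}"

text \<open>
  Increments are normalised to be 0 off the simplex: then functions on the simplex correspond to
  honest HOL functions, equality of increments is equality, and linear operations are pointwise.
\<close>

definition cont_increments ::
    "real \<Rightarrow> 'a::real_vector set \<Rightarrow> ('a \<Rightarrow> real) \<Rightarrow> nat \<Rightarrow> (real list \<Rightarrow> 'a) set" where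
  "cont_increments T B nrm n =
     {g. (\<forall>ts\<in>simplex_T T n. g ts \<in> B) \<and>
         (\<forall>ts\<in>simplex_T T n. \<forall>e>0. \<exists>d>0. \<forall>us\<in>simplex_T T n.
            (\<forall>i<n. \<bar>us ! i - ts ! i\<bar> < d) \<longrightarrow> nrm (g us - g ts) < e) \<and>
         (\<forall>ts. ts \<notin> simplex_T T n \<longrightarrow> g ts = 0)}"

text \<open>List positions count from 0, whence the exponent Suc i.\<close>

definition hat_delta ::
    "(real \<Rightarrow> 'a::real_vector \<Rightarrow> 'a) \<Rightarrow> (real list \<Rightarrow> 'a) \<Rightarrow> real list \<Rightarrow> 'a" where
  "hat_delta S g ts =
     (\<Sum>i<length ts. (-1) ^ Suc i *\<^sub>R g (take i ts @ drop (Suc i) ts))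
     - (S (ts ! 0 - ts ! 1) (g (tl ts)) - g (tl ts))"

lemma hat_delta_2: "hat_delta S g [t, u, s] = g [t, s] - g [t, u] - S (t - u) (g [u, s])"
  by (simp add: hat_delta_def)

definition enorm2 :: "real \<Rightarrow> ('a \<Rightarrow> real) \<Rightarrow> real \<Rightarrow> (real list \<Rightarrow> 'a) \<Rightarrow> ennreal" where
  "enorm2 T nrm \<gamma> g =
     (SUP (t, s)\<in>{(t, s). 0 \<le> s \<and> s < t \<and> t \<le> T}. ennreal (nrm (g [t, s]) / \<bar>t - s\<bar> powr \<gamma>))"

definition enorm3_weighted ::
    "real \<Rightarrow> ('a \<Rightarrow> real) \<Rightarrow> real \<Rightarrow> real \<Rightarrow> (real list \<Rightarrow> 'a) \<Rightarrow> ennreal" where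
  "enorm3_weighted T nrm \<gamma> \<rho> h =
     (SUP (t, u, s)\<in>{(t, u, s). 0 \<le> s \<and> s < u \<and> u < t \<and> t \<le> T}.
        ennreal (nrm (h [t, u, s]) / (\<bar>t - u\<bar> powr \<rho> * \<bar>u - s\<bar> powr (\<gamma> - \<rho>))))"

definition enorm3 ::
    "real \<Rightarrow> 'a::real_vector set \<Rightarrow> ('a \<Rightarrow> real) \<Rightarrow> real \<Rightarrow> (real list \<Rightarrow> 'a) \<Rightarrow> ennreal" where
  "enorm3 T B nrm \<gamma> h =
     Inf {\<Sum>j<m. enorm3_weighted T nrm \<gamma> (\<rho> j) (hs j) | m \<rho> hs.
            (\<forall>j<m. 0 < \<rho> j \<and> \<rho> j < \<gamma> \<and> hs j \<in> cont_increments T B nrm 3) \<and>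
            h = (\<lambda>ts. \<Sum>j<(m::nat). hs j ts)}"

definition holder2 ::
    "real \<Rightarrow> 'a::real_vector set \<Rightarrow> ('a \<Rightarrow> real) \<Rightarrow> real \<Rightarrow> (real list \<Rightarrow> 'a) set" where
  "holder2 T B nrm \<gamma> = {g \<in> cont_increments T B nrm 2. enorm2 T nrm \<gamma> g < \<infinity>}"

definition holder3 ::
    "real \<Rightarrow> 'a::real_vector set \<Rightarrow> ('a \<Rightarrow> real) \<Rightarrow> real \<Rightarrow> (real list \<Rightarrow> 'a) set" where
  "holder3 T B nrm \<gamma> = {h \<in> cont_increments T B nrm 3. enorm3 T B nrm \<gamma> h < \<infinity>}"

definition norm2 :: "real \<Rightarrow> ('a \<Rightarrow> real) \<Rightarrow> real \<Rightarrow> (real list \<Rightarrow> 'a) \<Rightarrow> real" where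
  "norm2 T nrm \<gamma> g = enn2real (enorm2 T nrm \<gamma> g)"

definition norm3 ::
    "real \<Rightarrow> 'a::real_vector set \<Rightarrow> ('a \<Rightarrow> real) \<Rightarrow> real \<Rightarrow> (real list \<Rightarrow> 'a) \<Rightarrow> real" where
  "norm3 T B nrm \<gamma> h = enn2real (enorm3 T B nrm \<gamma> h)"

definition Z_holder3 ::
    "real \<Rightarrow> 'a::real_vector set \<Rightarrow> ('a \<Rightarrow> real) \<Rightarrow> (real \<Rightarrow> 'a \<Rightarrow> 'a) \<Rightarrow> real \<Rightarrow> (real list \<Rightarrow> 'a) set" where
  "Z_holder3 T B nrm S \<gamma> =
     {h \<in> holder3 T B nrm \<gamma>. \<forall>ts\<in>simplex_T T 4. hat_delta S h ts = 0}"


section \<open>Dyadic recursion\<close>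

definition dyadic_level :: "real \<Rightarrow> nat \<Rightarrow> real set" where
  "dyadic_level T n = {real k * T / 2 ^ n | k. k \<le> 2 ^ n}"

definition dyadics :: "real \<Rightarrow> real set" where
  "dyadics T = (\<Union>n. dyadic_level T n)"

definition dyadic_intervals :: "real \<Rightarrow> (real \<times> real) set" where
  "dyadic_intervals T = {(real k * T / 2 ^ n, real (Suc k) * T / 2 ^ n) | k n. k < 2 ^ n}"

definition germ :: "(real list \<Rightarrow> 'a::real_vector) \<Rightarrow> real \<Rightarrow> real \<Rightarrow> 'a" where
  "germ H t s = - H [t, s, 0]"

text \<open>
  A splitting rule maps the end points a, c of a dyadic interval and the residual carried by it to
  the pair of child residuals, the one on [b, c] first and the one on [a, b] second.
\<close>

type_synonym 'a splitting = "real \<Rightarrow> real \<Rightarrow> 'a \<Rightarrow> 'a \<times> 'a"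

text \<open>The path after n rounds; its values are meaningful at the points of level n only.\<close>

primrec path_level ::
    "(real \<Rightarrow> 'a::real_vector \<Rightarrow> 'a) \<Rightarrow> real \<Rightarrow> 'a splitting \<Rightarrow> (real list \<Rightarrow> 'a) \<Rightarrow> nat \<Rightarrow> real \<Rightarrow> 'a" where
  "path_level S T sp H 0 = (\<lambda>t. if t = T then germ H T 0 else 0)"
| "path_level S T sp H (Suc n) = (\<lambda>b.
     if b \<in> dyadic_level T n then path_level S T sp H n b
     else let a = b - T / 2 ^ Suc n; c = b + T / 2 ^ Suc n;
              Q = germ H c a - path_level S T sp H n c + S (c - a) (path_level S T sp H n a)
          in germ H b a + S (b - a) (path_level S T sp H n a) - snd (sp a c Q))"

definition dyadic_path ::
    "(real \<Rightarrow> 'a::real_vector \<Rightarrow> 'a) \<Rightarrow> real \<Rightarrow> 'a splitting \<Rightarrow> (real list \<Rightarrow> 'a) \<Rightarrow> real \<Rightarrow> 'a" where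
  "dyadic_path S T sp H t = path_level S T sp H (LEAST n. t \<in> dyadic_level T n) t"

definition residual ::
    "(real \<Rightarrow> 'a::real_vector \<Rightarrow> 'a) \<Rightarrow> real \<Rightarrow> 'a splitting \<Rightarrow> (real list \<Rightarrow> 'a) \<Rightarrow> real \<Rightarrow> real \<Rightarrow> 'a" where
  "residual S T sp H t s = germ H t s - dyadic_path S T sp H t + S (t - s) (dyadic_path S T sp H s)"

text \<open>The generated residual on a dyadic interval [a, c] is residual S T sp H c a.\<close>

definition splitting_rule ::
    "real \<Rightarrow> 'a::real_vector set \<Rightarrow> (real \<Rightarrow> 'a \<Rightarrow> 'a) \<Rightarrow> 'a splitting \<Rightarrow> (real list \<Rightarrow> 'a) \<Rightarrow> bool" where
  "splitting_rule T B S sp H \<longleftrightarrow>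
     (\<forall>(a, c)\<in>dyadic_intervals T.
        let b = (a + c) / 2; Q = residual S T sp H c a; Q_cb = fst (sp a c Q); Q_ba = snd (sp a c Q)
        in Q_cb \<in> B \<and> Q_ba \<in> B \<and> Q = Q_cb + S (c - b) Q_ba + H [c, b, a])"

definition subcritical_admissible ::
    "real \<Rightarrow> ('a::real_vector \<Rightarrow> real) \<Rightarrow> (real \<Rightarrow> 'a \<Rightarrow> 'a) \<Rightarrow> real \<Rightarrow> real \<Rightarrow> real \<Rightarrow>
     'a splitting \<Rightarrow> (real list \<Rightarrow> 'a) \<Rightarrow> bool" where
  "subcritical_admissible T nrm S \<gamma> \<theta> C_H sp H \<longleftrightarrow>
     0 \<le> \<theta> \<and> \<theta> < 2 powr (-\<gamma>) \<and> 0 \<le> C_H \<and>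
     (\<forall>(a, c)\<in>dyadic_intervals T.
        let Q = residual S T sp H c a; Q_cb = fst (sp a c Q); Q_ba = snd (sp a c Q)
        in max (nrm Q_cb) (nrm Q_ba) \<le> \<theta> * nrm Q + C_H * (c - a) powr \<gamma>)"

definition residual_continuity ::
    "real \<Rightarrow> ('a::real_vector \<Rightarrow> real) \<Rightarrow> (real \<Rightarrow> 'a \<Rightarrow> 'a) \<Rightarrow> 'a splitting \<Rightarrow>
     (real list \<Rightarrow> 'a) \<Rightarrow> bool" where
  "residual_continuity T nrm S sp H \<longleftrightarrow>
     ((\<lambda>h. SUP (t, s)\<in>{(t, s). t \<in> dyadics T \<and> s \<in> dyadics T \<and> s \<le> t \<and> t + h \<le> T}.
        ennreal (nrm (S h (residual S T sp H t s) - residual S T sp H t s))) \<longlongrightarrow> 0) (at_right 0)"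

text \<open>
  In a selection domain the rule may depend on the defect H; the rule used for H is \<open>\<sigma> H\<close>. The fourth
  conjunct is linearity of the rule: the generated residuals depend linearly on H.
\<close>

definition selection_domain ::
    "real \<Rightarrow> 'a::real_vector set \<Rightarrow> ('a \<Rightarrow> real) \<Rightarrow> (real \<Rightarrow> 'a \<Rightarrow> 'a) \<Rightarrow> real \<Rightarrow> real \<Rightarrow> real \<Rightarrow>
     ((real list \<Rightarrow> 'a) \<Rightarrow> 'a splitting) \<Rightarrow> (real list \<Rightarrow> 'a) set \<Rightarrow> bool" where
  "selection_domain T B nrm S \<gamma> \<theta> C_s \<sigma> D \<longleftrightarrow>
     D \<subseteq> Z_holder3 T B nrm S \<gamma> \<and>
     (\<lambda>_. 0) \<in> D \<and>
     (\<forall>H\<in>D. \<forall>K\<in>D. \<forall>x y. (\<lambda>ts. x *\<^sub>R H ts + y *\<^sub>R K ts) \<in> D) \<and>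
     (\<forall>H\<in>D. \<forall>K\<in>D. \<forall>x y. \<forall>(a, c)\<in>dyadic_intervals T.
        residual S T (\<sigma> (\<lambda>ts. x *\<^sub>R H ts + y *\<^sub>R K ts)) (\<lambda>ts. x *\<^sub>R H ts + y *\<^sub>R K ts) c a
        = x *\<^sub>R residual S T (\<sigma> H) H c a + y *\<^sub>R residual S T (\<sigma> K) K c a) \<and>
     (\<forall>H\<in>D. splitting_rule T B S (\<sigma> H) H \<and>
        (\<exists>C_H. C_H \<le> C_s * norm3 T B nrm \<gamma> H \<and>
           subcritical_admissible T nrm S \<gamma> \<theta> C_H (\<sigma> H) H) \<and>
        residual_continuity T nrm S (\<sigma> H) H)"


section \<open>The map\<close>

definition extends_residual ::
    "real \<Rightarrow> 'a::real_vector set \<Rightarrow> ('a \<Rightarrow> real) \<Rightarrow> (real \<Rightarrow> 'a \<Rightarrow> 'a) \<Rightarrow> 'a splitting \<Rightarrow>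
     (real list \<Rightarrow> 'a) \<Rightarrow> (real list \<Rightarrow> 'a) \<Rightarrow> bool" where
  "extends_residual T B nrm S sp H g \<longleftrightarrow>
     g \<in> cont_increments T B nrm 2 \<and>
     (\<forall>t\<in>dyadics T. \<forall>s\<in>dyadics T. s \<le> t \<longrightarrow> g [t, s] = residual S T sp H t s)"

text \<open>Meaningful only where the extension exists and is unique.\<close>

definition hat_Lambda ::
    "real \<Rightarrow> 'a::real_vector set \<Rightarrow> ('a \<Rightarrow> real) \<Rightarrow> (real \<Rightarrow> 'a \<Rightarrow> 'a) \<Rightarrow> 'a splitting \<Rightarrow>
     (real list \<Rightarrow> 'a) \<Rightarrow> real list \<Rightarrow> 'a" where
  "hat_Lambda T B nrm S sp H = (THE g. extends_residual T B nrm S sp H g)"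

end

theory Submission
  imports Defs
begin

text \<open>
  Write \<open>A t s = - H [t, s, 0]\<close> for the germ, I for the path built by the recursion and
  \<open>R t s = A t s - I t + S (t - s) (I s)\<close> for the residual. The cocycle equation says that the reduced
  increment of A is H, and the two terms with I cancel in every reduced increment, whatever the path
  is; hence \<open>R t s = R t u + S (t - u) (R u s) + H [t, u, s]\<close>. On a dyadic interval this relation is
  the splitting equation, so that the children proposed by the rule are the actual residuals of the
  two halves (\<open>residual_children\<close>).

  The Hoelder bound is a sewing argument below the usual threshold \<open>\<gamma> = 1\<close>, in which the rule replaces the
  missing exponent. From one level to the next the largest residual is multiplied by at most
  \<open>\<theta>\<close>, up to \<open>C_H * L powr \<gamma>\<close> for intervals of length L, while \<open>L powr \<gamma>\<close> is multiplied by
  \<open>2 powr (- \<gamma>)\<close>. As \<open>\<theta> < 2 powr (- \<gamma>)\<close> and the root residual vanishes, all residuals on dyadic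
  intervals are of order \<open>C_H * L powr \<gamma>\<close> (\<open>level_bound\<close>). An arbitrary dyadic pair is
  decomposed into dyadic intervals, boundedly many of each length (\<open>chain_right\<close>, \<open>chain_left\<close>).
  The defects met on the way are at most \<open>norm3\<close> times \<open>L powr \<gamma>\<close>, and the sum over
  the levels is geometric (\<open>dyadic_holder_bound\<close>). The semigroup enters through one constant
  only, its bound on [0, T], which strong continuity and the Banach--Steinhaus theorem provide.

  To leave the dyadic numbers it is enough to extend the path. As \<open>I t = - R t 0\<close>, its increments
  consist of a residual on a short interval, of an increment of the semigroup applied to a residual,
  and of H near its diagonal. The Hoelder bound, the residual continuity criterion and the
  continuity of H make them small (\<open>path_locally_Cauchy\<close>), so the path extends continuously to
  [0, T]. Replacing it by its extension in the formula for R gives a continuous increment whose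
  reduced increment is H by the same cancellation, and which inherits the Hoelder bound by density.

  Density also gives uniqueness, and with it linearity, once the path is known to depend linearly on
  H. That follows from linearity on dyadic intervals by moving along the grid of each level
  (\<open>path_linear\<close>). Continuity of the map is then its norm bound applied to a difference.
\<close>

section \<open>Banach spaces inside an ambient vector space\<close>

locale banach_on =
  fixes B :: "'a::real_vector set" and nrm :: "'a \<Rightarrow> real"
  assumes banach: "banach_space_on B nrm"
begin

lemma subspace: "subspace B"
  using banach by (simp add: banach_space_on_def)

lemma zero_mem [simp]: "0 \<in> B"
  and add_mem [simp]: "x \<in> B \<Longrightarrow> y \<in> B \<Longrightarrow> x + y \<in> B"
  and diff_mem [simp]: "x \<in> B \<Longrightarrow> y \<in> B \<Longrightarrow> x - y \<in> B"
  and minus_mem [simp]: "x \<in> B \<Longrightarrow> - x \<in> B"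
  and scale_mem [simp]: "x \<in> B \<Longrightarrow> c *\<^sub>R x \<in> B"
  using subspace by (auto intro: subspace_0 subspace_add subspace_diff subspace_neg subspace_scale)

lemma nrm_nonneg [simp]: "x \<in> B \<Longrightarrow> 0 \<le> nrm x"
  and nrm_eq_0: "x \<in> B \<Longrightarrow> nrm x = 0 \<longleftrightarrow> x = 0"
  and nrm_triangle: "x \<in> B \<Longrightarrow> y \<in> B \<Longrightarrow> nrm (x + y) \<le> nrm x + nrm y"
  and nrm_scale: "x \<in> B \<Longrightarrow> nrm (c *\<^sub>R x) = \<bar>c\<bar> * nrm x"
  using banach by (auto simp: banach_space_on_def)

lemma nrm_zero [simp]: "nrm 0 = 0"
  using nrm_eq_0[of 0] by simp

lemma nrm_minus [simp]: "x \<in> B \<Longrightarrow> nrm (- x) = nrm x"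
  using nrm_scale[of x "-1"] by simp

lemma nrm_diff_commute: "x \<in> B \<Longrightarrow> y \<in> B \<Longrightarrow> nrm (x - y) = nrm (y - x)"
  using nrm_minus[of "y - x"] by simp

lemma nrm_diff_triangle:
  "x \<in> B \<Longrightarrow> y \<in> B \<Longrightarrow> z \<in> B \<Longrightarrow> nrm (x - z) \<le> nrm (x - y) + nrm (y - z)"
  using nrm_triangle[of "x - y" "y - z"] by simp

lemma nrm_le_add_diff: "x \<in> B \<Longrightarrow> y \<in> B \<Longrightarrow> nrm x \<le> nrm y + nrm (x - y)"
  using nrm_triangle[of y "x - y"] by simp

lemma nrm_diff_le: "x \<in> B \<Longrightarrow> y \<in> B \<Longrightarrow> nrm (x - y) \<le> nrm x + nrm y"
  using nrm_triangle[of x "- y"] by simp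

lemma nrm_sum_le:
  "(\<And>i. i \<in> A \<Longrightarrow> f i \<in> B) \<Longrightarrow> nrm (\<Sum>i\<in>A. f i) \<le> (\<Sum>i\<in>A. nrm (f i))"
proof (induction A rule: infinite_finite_induct)
  case (insert a A)
  have "(\<Sum>i\<in>A. f i) \<in> B"
    using insert.prems subspace by (intro subspace_sum) auto
  then have "nrm (f a + (\<Sum>i\<in>A. f i)) \<le> nrm (f a) + nrm (\<Sum>i\<in>A. f i)"
    using insert.prems by (intro nrm_triangle) auto
  also have "nrm (\<Sum>i\<in>A. f i) \<le> (\<Sum>i\<in>A. nrm (f i))"
    using insert by auto
  finally show ?case
    using insert.hyps by simp
qed auto

lemma tendsto_nrm:
  assumes "\<And>n. u n \<in> B" "x \<in> B" "((\<lambda>n. nrm (u n - x)) \<longlongrightarrow> 0) F"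
  shows "((\<lambda>n. nrm (u n)) \<longlongrightarrow> nrm x) F"
proof -
  have "\<bar>nrm (u n) - nrm x\<bar> \<le> nrm (u n - x)" for n
    using nrm_le_add_diff[of "u n" x] nrm_le_add_diff[of x "u n"] nrm_diff_commute[of x "u n"]
      assms by auto
  then have "((\<lambda>n. nrm (u n) - nrm x) \<longlongrightarrow> 0) F"
    by (intro Lim_null_comparison[OF _ assms(3)]) auto
  then show ?thesis
    using LIM_zero_iff by blast
qed

lemma eqI_nrm:
  assumes "x \<in> B" "y \<in> B" "\<And>e. e > 0 \<Longrightarrow> nrm (x - y) \<le> e"
  shows "x = y"
proof -
  have "nrm (x - y) \<le> 0"
    using assms(3) by (rule field_le_epsilon[of _ 0, simplified])
  then have "nrm (x - y) = 0"
    using nrm_nonneg[OF diff_mem[OF assms(1,2)]] by linarith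
  then show ?thesis
    using nrm_eq_0[of "x - y"] assms by auto
qed

lemma Cauchy_limit:
  assumes "\<And>n::nat. u n \<in> B"
    and "\<And>e. e > 0 \<Longrightarrow> \<exists>M. \<forall>m\<ge>M. \<forall>n\<ge>M. nrm (u m - u n) < e"
  obtains x where "x \<in> B" "(\<lambda>n. nrm (u n - x)) \<longlonglongrightarrow> 0"
proof -
  have "\<forall>u. (\<forall>n::nat. u n \<in> B) \<longrightarrow> (\<forall>e>0. \<exists>M. \<forall>m\<ge>M. \<forall>n\<ge>M. nrm (u m - u n) < e) \<longrightarrow>
      (\<exists>x\<in>B. (\<lambda>n. nrm (u n - x)) \<longlonglongrightarrow> 0)"
    using banach unfolding banach_space_on_def by (elim conjE)
  then have "\<exists>x\<in>B. (\<lambda>n. nrm (u n - x)) \<longlonglongrightarrow> 0"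
    using assms by simp
  then show ?thesis
    using that by blast
qed

lemma bounded_operator_mem: "bounded_operator_on B nrm L \<Longrightarrow> x \<in> B \<Longrightarrow> L x \<in> B"
  by (simp add: bounded_operator_on_def)

lemma bounded_operator_lin:
  "bounded_operator_on B nrm L \<Longrightarrow> x \<in> B \<Longrightarrow> y \<in> B \<Longrightarrow>
     L (a *\<^sub>R x + b *\<^sub>R y) = a *\<^sub>R L x + b *\<^sub>R L y"
  by (simp add: bounded_operator_on_def)

lemma bounded_operator_add:
  "bounded_operator_on B nrm L \<Longrightarrow> x \<in> B \<Longrightarrow> y \<in> B \<Longrightarrow> L (x + y) = L x + L y"
  using bounded_operator_lin[of L x y 1 1] by simp

lemma bounded_operator_diff:
  "bounded_operator_on B nrm L \<Longrightarrow> x \<in> B \<Longrightarrow> y \<in> B \<Longrightarrow> L (x - y) = L x - L y"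
  using bounded_operator_lin[of L x y 1 "-1"] by simp

lemma bounded_operator_scale:
  "bounded_operator_on B nrm L \<Longrightarrow> x \<in> B \<Longrightarrow> L (a *\<^sub>R x) = a *\<^sub>R L x"
  using bounded_operator_lin[of L x 0 a 0] by simp

text \<open>
  By Baire's theorem one of the closed sets on which all operators are bounded by a fixed n contains
  a ball; translating that ball to the origin at most doubles the bound (Banach--Steinhaus).
\<close>

lemma uniform_boundedness:
  assumes L: "\<And>i. i \<in> J \<Longrightarrow> bounded_operator_on B nrm (L i)"
    and ptw: "\<And>x. x \<in> B \<Longrightarrow> \<exists>C. \<forall>i\<in>J. nrm (L i x) \<le> C"
  shows "\<exists>M\<ge>1. \<forall>i\<in>J. \<forall>x\<in>B. nrm (L i x) \<le> M * nrm x"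
proof -
  \<comment> \<open>A metric space on a carrier has a distance that is nonnegative and symmetric off it as well.\<close>
  define d where "d x y = (if x \<in> B \<and> y \<in> B then nrm (x - y) else 0)" for x y
  interpret ms: Metric_space B d
    by unfold_locales (auto simp: d_def nrm_eq_0 nrm_diff_commute intro: nrm_diff_triangle)
  have lim: "limitin ms.mtopology u x sequentially \<longleftrightarrow>
      x \<in> B \<and> (\<forall>n. u n \<in> B) \<and> (\<lambda>n. nrm (u n - x)) \<longlonglongrightarrow> 0" if "\<And>n. u n \<in> B" for u x
    using that by (auto simp: ms.limitin_metric_dist_null d_def cong: conj_cong)
  define F where "F n = {x \<in> B. \<forall>i\<in>J. nrm (L i x) \<le> real n}" for n
  have closed: "closedin ms.mtopology (F n)" for n
    unfolding ms.metric_closedin_iff_sequentially_closed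
  proof (intro conjI allI impI)
    show "F n \<subseteq> B" by (auto simp: F_def)
    fix u x assume u: "range u \<subseteq> F n \<and> limitin ms.mtopology u x sequentially"
    then have uB: "u k \<in> B" and ub: "i \<in> J \<Longrightarrow> nrm (L i (u k)) \<le> real n" for i k
      by (auto simp: F_def)
    have x: "x \<in> B" and ux: "(\<lambda>k. nrm (u k - x)) \<longlonglongrightarrow> 0"
      using u lim[of u x] uB by auto
    have "nrm (L i x) \<le> real n" if i: "i \<in> J" for i
    proof -
      obtain C where C: "\<And>y. y \<in> B \<Longrightarrow> nrm (L i y) \<le> C * nrm y"
        using L[OF i] unfolding bounded_operator_on_def by blast
      have "(\<lambda>k. nrm (L i (u k) - L i x)) \<longlonglongrightarrow> 0"
      proof (rule Lim_null_comparison)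
        show "(\<lambda>k. C * nrm (u k - x)) \<longlonglongrightarrow> 0"
          using tendsto_mult_right_zero[OF ux] .
        show "\<forall>\<^sub>F k in sequentially. norm (nrm (L i (u k) - L i x)) \<le> C * nrm (u k - x)"
          using C uB x bounded_operator_diff[OF L[OF i]] bounded_operator_mem[OF L[OF i]]
          by (auto simp: bounded_operator_diff[OF L[OF i], symmetric] intro!: always_eventually)
      qed
      then have "(\<lambda>k. nrm (L i (u k))) \<longlonglongrightarrow> nrm (L i x)"
        using uB x bounded_operator_mem[OF L[OF i]] by (intro tendsto_nrm) auto
      then show ?thesis
        by (rule LIMSEQ_le_const2) (use ub[OF i] in auto)
    qed
    then show "x \<in> F n"
      using x by (auto simp: F_def)
  qed
  have "ms.mcomplete"
    unfolding ms.mcomplete_def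
  proof (intro allI impI)
    fix u assume "ms.MCauchy u"
    then have uB: "u n \<in> B" and cau: "e > 0 \<Longrightarrow> \<exists>N. \<forall>m\<ge>N. \<forall>n\<ge>N. nrm (u m - u n) < e" for n e
      unfolding ms.MCauchy_def by (auto simp: d_def range_subsetD)
    obtain x where "x \<in> B" "(\<lambda>n. nrm (u n - x)) \<longlonglongrightarrow> 0"
      using Cauchy_limit[of u] uB cau by metis
    then show "\<exists>x. limitin ms.mtopology u x sequentially"
      using lim[of u x] uB by blast
  qed
  moreover have "\<Union>(range F) = B"
  proof -
    have "\<exists>n. x \<in> F n" if "x \<in> B" for x
    proof -
      obtain C where "\<forall>i\<in>J. nrm (L i x) \<le> C" using ptw \<open>x \<in> B\<close> by blast
      moreover obtain n where "C \<le> real n" using real_arch_simple by blast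
      ultimately have "x \<in> F n" using \<open>x \<in> B\<close> by (auto simp: F_def)
      then show ?thesis ..
    qed
    then show ?thesis by (auto simp: F_def)
  qed
  moreover have "ms.mtopology interior_of B \<noteq> {}"
    using zero_mem interior_of_topspace[of ms.mtopology] ms.topspace_mtopology empty_iff by metis
  ultimately obtain n where "ms.mtopology interior_of F n \<noteq> {}"
    using ms.metric_Baire_category_alt[of "range F"] closed by force
  then obtain x r where x: "x \<in> B" and r: "r > 0" and sub: "ms.mcball x r \<subseteq> F n"
    by (auto simp: ms.in_interior_of_mcball)
  have est: "nrm (L i y) \<le> 2 * real n / r * nrm y" if i: "i \<in> J" and y: "y \<in> B" for i y
  proof (cases "y = 0")
    case True
    then show ?thesis
      using bounded_operator_diff[OF L[OF i], of 0 0] by simp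
  next
    case False
    then have pos: "nrm y > 0"
      using nrm_eq_0[OF y] nrm_nonneg[OF y] by linarith
    define c where "c = r / nrm y"
    have c: "c > 0" using pos r by (simp add: c_def)
    have "x \<in> F n"
      using sub x r by (auto simp: ms.in_mcball d_def)
    moreover have "x + c *\<^sub>R y \<in> F n"
      using sub x y r c pos by (auto simp: ms.in_mcball d_def nrm_scale c_def)
    ultimately have "nrm (L i (x + c *\<^sub>R y)) \<le> real n" "nrm (L i x) \<le> real n"
      using i by (auto simp: F_def)
    moreover have "c *\<^sub>R L i y = L i (x + c *\<^sub>R y) - L i x"
      using x y by (simp add: bounded_operator_add[OF L[OF i]] bounded_operator_scale[OF L[OF i]])
    ultimately have "c * nrm (L i y) \<le> 2 * real n"
      using x y c nrm_diff_le[of "L i (x + c *\<^sub>R y)" "L i x"] bounded_operator_mem[OF L[OF i]]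
        nrm_scale[of "L i y" c] by simp
    then show ?thesis
      using pos r by (simp add: c_def field_simps)
  qed
  show ?thesis
  proof (intro exI[of _ "max 1 (2 * real n / r)"] conjI ballI)
    fix i y assume "i \<in> J" "y \<in> B"
    then show "nrm (L i y) \<le> max 1 (2 * real n / r) * nrm y"
      using est[of i y] mult_right_mono[of "2 * real n / r" "max 1 (2 * real n / r)" "nrm y"]
      by (auto intro: order_trans)
  qed simp
qed

text \<open>
  The value at t is the limit along one sequence of D that converges to t. As the Cauchy condition at
  t concerns all of D, it is also the limit at t along D, and comparing two values through a common
  nearby point of D gives continuity.
\<close>

lemma extend_from_dense:
  fixes f :: "real \<Rightarrow> 'a" and X D :: "real set"
  assumes dense: "X \<subseteq> closure D" and D: "D \<subseteq> X"
    and f: "\<And>p. p \<in> D \<Longrightarrow> f p \<in> B"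
    and cau: "\<And>t e. t \<in> X \<Longrightarrow> e > 0 \<Longrightarrow>
      \<exists>d>0. \<forall>p\<in>D. \<forall>q\<in>D. \<bar>p - t\<bar> < d \<longrightarrow> \<bar>q - t\<bar> < d \<longrightarrow> nrm (f p - f q) < e"
  obtains F where "\<And>t. t \<in> X \<Longrightarrow> F t \<in> B" "\<And>p. p \<in> D \<Longrightarrow> F p = f p"
    "\<And>t e. t \<in> X \<Longrightarrow> e > 0 \<Longrightarrow> \<exists>d>0. \<forall>u\<in>X. \<bar>u - t\<bar> < d \<longrightarrow> nrm (F u - F t) < e"
proof -
  have near: "\<exists>p\<in>D. \<bar>p - t\<bar> < d" if "t \<in> X" "d > 0" for t d
    using subsetD[OF dense that(1)] that(2) by (simp add: closure_approachable dist_real_def)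
  have "\<exists>x\<in>B. \<forall>e>0. \<exists>d>0. \<forall>p\<in>D. \<bar>p - t\<bar> < d \<longrightarrow> nrm (f p - x) < e" if t: "t \<in> X" for t
  proof -
    obtain p where p: "\<And>n. p n \<in> D" and pt: "p \<longlonglongrightarrow> t"
      using subsetD[OF dense t] unfolding closure_sequential by blast
    have ev: "\<exists>M. \<forall>n\<ge>M. \<bar>p n - t\<bar> < d" if "d > 0" for d
      using LIMSEQ_D[OF pt that] by simp
    obtain x where x: "x \<in> B" "(\<lambda>n. nrm (f (p n) - x)) \<longlonglongrightarrow> 0"
    proof (rule Cauchy_limit)
      show "f (p n) \<in> B" for n using p f by blast
      show "\<exists>M. \<forall>m\<ge>M. \<forall>n\<ge>M. nrm (f (p m) - f (p n)) < e" if e: "e > 0" for e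
      proof -
        obtain d where d: "d > 0"
          "\<And>p q. p \<in> D \<Longrightarrow> q \<in> D \<Longrightarrow> \<bar>p - t\<bar> < d \<Longrightarrow> \<bar>q - t\<bar> < d \<Longrightarrow> nrm (f p - f q) < e"
          using cau[OF t e] by auto
        obtain M where "\<And>n. n \<ge> M \<Longrightarrow> \<bar>p n - t\<bar> < d"
          using ev[OF d(1)] by blast
        then show ?thesis
          using d(2) p by blast
      qed
    qed
    have "\<exists>d>0. \<forall>q\<in>D. \<bar>q - t\<bar> < d \<longrightarrow> nrm (f q - x) < e" if e: "e > 0" for e
    proof -
      obtain d where d: "d > 0"
        "\<And>p q. p \<in> D \<Longrightarrow> q \<in> D \<Longrightarrow> \<bar>p - t\<bar> < d \<Longrightarrow> \<bar>q - t\<bar> < d \<Longrightarrow> nrm (f p - f q) < e / 2"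
        using cau[OF t, of "e / 2"] e by auto
      obtain M where "\<forall>n\<ge>M. \<bar>p n - t\<bar> < d"
        using ev[OF \<open>d > 0\<close>] by blast
      moreover obtain M' where "\<forall>n\<ge>M'. nrm (f (p n) - x) < e / 2"
        using LIMSEQ_D[OF x(2), of "e / 2"] e by fastforce
      ultimately have n: "\<bar>p (max M M') - t\<bar> < d" "nrm (f (p (max M M')) - x) < e / 2"
        by auto
      have "nrm (f q - x) < e" if q: "q \<in> D" "\<bar>q - t\<bar> < d" for q
        using nrm_diff_triangle[of "f q" "f (p (max M M'))" x] d(2)[OF q(1) p q(2) n(1)] n(2)
          f[OF q(1)] f[OF p] x(1) by auto
      then show ?thesis using d(1) by blast
    qed
    then show ?thesis using x(1) by blast
  qed
  then have "\<forall>t\<in>X. \<exists>x. x \<in> B \<and> (\<forall>e>0. \<exists>d>0. \<forall>p\<in>D. \<bar>p - t\<bar> < d \<longrightarrow> nrm (f p - x) < e)"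
    by blast
  from bchoice[OF this] obtain F where F: "\<And>t. t \<in> X \<Longrightarrow> F t \<in> B"
    "\<And>t e. t \<in> X \<Longrightarrow> e > 0 \<Longrightarrow> \<exists>d>0. \<forall>p\<in>D. \<bar>p - t\<bar> < d \<longrightarrow> nrm (f p - F t) < e"
    by blast
  show ?thesis
  proof (rule that)
    fix p assume p: "p \<in> D"
    have "f p = F p"
    proof (rule eqI_nrm)
      show "f p \<in> B" "F p \<in> B" using p D f F(1) by auto
      fix e :: real assume "e > 0"
      then show "nrm (f p - F p) \<le> e"
        using F(2)[of p e] p D by force
    qed
    then show "F p = f p" by simp
  next
    fix t e :: real assume t: "t \<in> X" and e: "e > 0"
    obtain d where d: "d > 0" "\<And>p. p \<in> D \<Longrightarrow> \<bar>p - t\<bar> < d \<Longrightarrow> nrm (f p - F t) < e / 2"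
      using F(2)[OF t, of "e / 2"] e by auto
    have "nrm (F u - F t) < e" if u: "u \<in> X" "\<bar>u - t\<bar> < d" for u
    proof -
      obtain d' where d': "d' > 0" "\<And>p. p \<in> D \<Longrightarrow> \<bar>p - u\<bar> < d' \<Longrightarrow> nrm (f p - F u) < e / 2"
        using F(2)[OF u(1), of "e / 2"] e by auto
      obtain p where p: "p \<in> D" "\<bar>p - u\<bar> < min d' (d - \<bar>u - t\<bar>)"
        using near[OF u(1), of "min d' (d - \<bar>u - t\<bar>)"] d' u by auto
      have "nrm (f p - F u) < e / 2" "nrm (f p - F t) < e / 2"
        using p d(2)[of p] d'(2)[of p] by auto
      then show ?thesis
        using nrm_diff_triangle[of "F u" "f p" "F t"] nrm_diff_commute[of "F u" "f p"]
          F(1) t u(1) f[OF p(1)] by auto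
    qed
    then show "\<exists>d>0. \<forall>u\<in>X. \<bar>u - t\<bar> < d \<longrightarrow> nrm (F u - F t) < e"
      using d(1) by blast
  qed (use F(1) in blast)
qed

end


section \<open>Increments of finite norm\<close>

lemma simplex_T_2 [simp]: "[t, s] \<in> simplex_T T 2 \<longleftrightarrow> 0 \<le> s \<and> s \<le> t \<and> t \<le> T"
  and simplex_T_3 [simp]: "[t, u, s] \<in> simplex_T T 3 \<longleftrightarrow> 0 \<le> s \<and> s \<le> u \<and> u \<le> t \<and> t \<le> T"
  and simplex_T_4 [simp]: "[t, u, s, r] \<in> simplex_T T 4 \<longleftrightarrow>
    0 \<le> r \<and> r \<le> s \<and> s \<le> u \<and> u \<le> t \<and> t \<le> T"
  by (auto simp: simplex_T_def)

lemma simplex_T_2E: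
  assumes "ts \<in> simplex_T T 2"
  obtains t s where "ts = [t, s]" "0 \<le> s" "s \<le> t" "t \<le> T"
proof -
  obtain t s where "ts = [t, s]"
    using assms by (auto simp: simplex_T_def length_Suc_conv numeral_2_eq_2)
  then show ?thesis
    using that assms by simp
qed

lemma simplex_T_3E:
  assumes "ts \<in> simplex_T T 3"
  obtains t u s where "ts = [t, u, s]" "0 \<le> s" "s \<le> u" "u \<le> t" "t \<le> T"
proof -
  obtain t u s where "ts = [t, u, s]"
    using assms by (auto simp: simplex_T_def length_Suc_conv numeral_3_eq_3)
  then show ?thesis
    using that assms by simp
qed

lemma all_less_2: "(\<forall>i<2. Q i) \<longleftrightarrow> Q 0 \<and> Q (1::nat)"
  and all_less_3: "(\<forall>i<3. Q i) \<longleftrightarrow> Q 0 \<and> Q 1 \<and> Q (2::nat)"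
  by (auto simp: numeral_2_eq_2 numeral_3_eq_3 less_Suc_eq)

lemma hat_delta_3:
  "hat_delta S h [t, u, s, r] = h [t, s, r] - h [t, u, r] + h [t, u, s] - S (t - u) (h [u, s, r])"
  by (simp add: hat_delta_def)

context banach_on
begin

lemma cont_increments_mem:
  "g \<in> cont_increments T B nrm n \<Longrightarrow> ts \<in> simplex_T T n \<Longrightarrow> g ts \<in> B"
  by (simp add: cont_increments_def)

lemma cont_incrementsD:
  assumes "g \<in> cont_increments T B nrm n" "ts \<in> simplex_T T n" "0 < e"
  shows "\<exists>d>0. \<forall>us\<in>simplex_T T n. (\<forall>i<n. \<bar>us ! i - ts ! i\<bar> < d) \<longrightarrow> nrm (g us - g ts) < e"
  using assms by (simp add: cont_increments_def)

lemma cont_increments_tendsto: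
  assumes g: "g \<in> cont_increments T B nrm n" and ts: "ts \<in> simplex_T T n"
    and us: "\<And>k. us k \<in> simplex_T T n"
    and lim: "\<And>i. i < n \<Longrightarrow> (\<lambda>k. us k ! i) \<longlonglongrightarrow> ts ! i"
  shows "(\<lambda>k. nrm (g (us k) - g ts)) \<longlonglongrightarrow> 0"
proof (rule LIMSEQ_I)
  fix e :: real assume "0 < e"
  from cont_incrementsD[OF g ts this] obtain d where d: "d > 0"
    "\<And>us. us \<in> simplex_T T n \<Longrightarrow> (\<forall>i<n. \<bar>us ! i - ts ! i\<bar> < d) \<Longrightarrow> nrm (g us - g ts) < e"
    by blast
  have "\<forall>\<^sub>F k in sequentially. \<bar>us k ! i - ts ! i\<bar> < d" if "i < n" for i
    using tendstoD[OF lim[OF that] d(1)] by (simp add: dist_real_def)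
  then have "\<forall>\<^sub>F k in sequentially. \<forall>i\<in>{..<n}. \<bar>us k ! i - ts ! i\<bar> < d"
    by (intro eventually_ball_finite) auto
  then obtain k0 where "\<And>k. k \<ge> k0 \<Longrightarrow> \<forall>i<n. \<bar>us k ! i - ts ! i\<bar> < d"
    by (auto simp: eventually_sequentially)
  then have "nrm (g (us k) - g ts) < e" if "k \<ge> k0" for k
    using d(2) us that by blast
  moreover have "nrm (g (us k) - g ts) \<ge> 0" for k
    using cont_increments_mem[OF g] ts us by auto
  ultimately show "\<exists>no. \<forall>k\<ge>no. norm (nrm (g (us k) - g ts) - 0) < e"
    by auto
qed

text \<open>
  Each of the weights allowed in the norm of a three-increment is at most \<open>(t - s) powr \<gamma>\<close>, because
  both subintervals are shorter than [s, t].
\<close>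

lemma norm3_bound_strict:
  assumes h: "h \<in> holder3 T B nrm \<gamma>" and ord: "0 \<le> s" "s < u" "u < t" "t \<le> T"
  shows "nrm (h [t, u, s]) \<le> norm3 T B nrm \<gamma> h * (t - s) powr \<gamma>"
proof -
  have fin: "enorm3 T B nrm \<gamma> h < \<infinity>"
    using h by (simp add: holder3_def)
  have pos: "(t - s) powr \<gamma> > 0"
    using ord by simp
  have "ennreal (nrm (h [t, u, s]) / (t - s) powr \<gamma>) \<le> enorm3 T B nrm \<gamma> h"
    unfolding enorm3_def
  proof (rule Inf_greatest)
    fix y
    assume "y \<in> {\<Sum>j<m. enorm3_weighted T nrm \<gamma> (\<rho> j) (hs j) | m \<rho> hs.
            (\<forall>j<m. 0 < \<rho> j \<and> \<rho> j < \<gamma> \<and> hs j \<in> cont_increments T B nrm 3) \<and>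
            h = (\<lambda>ts. \<Sum>j<(m::nat). hs j ts)}"
    then obtain m :: nat and \<rho> hs where y: "y = (\<Sum>j<m. enorm3_weighted T nrm \<gamma> (\<rho> j) (hs j))"
      and *: "\<forall>j<m. 0 < \<rho> j \<and> \<rho> j < \<gamma> \<and> hs j \<in> cont_increments T B nrm 3"
      and hsum: "h = (\<lambda>ts. \<Sum>j<m. hs j ts)"
      by blast
    have mem: "hs j [t, u, s] \<in> B" if "j < m" for j
      using * that ord by (auto intro!: cont_increments_mem[of _ T 3])
    have "nrm (h [t, u, s]) \<le> (\<Sum>j<m. nrm (hs j [t, u, s]))"
      unfolding hsum using mem by (intro nrm_sum_le) auto
    then have "ennreal (nrm (h [t, u, s]) / (t - s) powr \<gamma>)
        \<le> ennreal (\<Sum>j<m. nrm (hs j [t, u, s]) / (t - s) powr \<gamma>)"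
      using pos by (intro ennreal_leI) (simp add: divide_right_mono flip: sum_divide_distrib)
    also have "\<dots> = (\<Sum>j<m. ennreal (nrm (hs j [t, u, s]) / (t - s) powr \<gamma>))"
      using mem by (intro sum_ennreal[symmetric]) auto
    also have "\<dots> \<le> (\<Sum>j<m. enorm3_weighted T nrm \<gamma> (\<rho> j) (hs j))"
    proof (rule sum_mono)
      fix j assume "j \<in> {..<m}"
      then have j: "j < m" by simp
      have \<rho>: "0 < \<rho> j" "\<rho> j < \<gamma>" using * j by auto
      have "\<bar>t - u\<bar> powr \<rho> j * \<bar>u - s\<bar> powr (\<gamma> - \<rho> j)
          \<le> (t - s) powr \<rho> j * (t - s) powr (\<gamma> - \<rho> j)"
        using \<rho> ord by (intro mult_mono powr_mono2) auto
      also have "\<dots> = (t - s) powr \<gamma>"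
        by (simp flip: powr_add)
      finally have "nrm (hs j [t, u, s]) / (t - s) powr \<gamma>
          \<le> nrm (hs j [t, u, s]) / (\<bar>t - u\<bar> powr \<rho> j * \<bar>u - s\<bar> powr (\<gamma> - \<rho> j))"
        using mem[OF j] ord by (intro divide_left_mono) auto
      then have "ennreal (nrm (hs j [t, u, s]) / (t - s) powr \<gamma>)
          \<le> ennreal (nrm (hs j [t, u, s]) / (\<bar>t - u\<bar> powr \<rho> j * \<bar>u - s\<bar> powr (\<gamma> - \<rho> j)))"
        by (rule ennreal_leI)
      also have "\<dots> \<le> enorm3_weighted T nrm \<gamma> (\<rho> j) (hs j)"
        unfolding enorm3_weighted_def using ord by (intro SUP_upper2[of "(t, u, s)"]) auto
      finally show "ennreal (nrm (hs j [t, u, s]) / (t - s) powr \<gamma>)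
          \<le> enorm3_weighted T nrm \<gamma> (\<rho> j) (hs j)" .
    qed
    finally show "ennreal (nrm (h [t, u, s]) / (t - s) powr \<gamma>) \<le> y"
      unfolding y .
  qed
  then have "enn2real (ennreal (nrm (h [t, u, s]) / (t - s) powr \<gamma>)) \<le> norm3 T B nrm \<gamma> h"
    unfolding norm3_def using fin by (intro enn2real_mono) auto
  moreover have "h [t, u, s] \<in> B"
    using h ord by (auto simp: holder3_def intro!: cont_increments_mem[of h T 3])
  ultimately show ?thesis
    using pos by (simp add: field_simps)
qed

text \<open>
  The degenerate points of the simplex are limits of strictly ordered triples along the segment to
  the interior point (T, T/2, 0).
\<close>

lemma norm3_bound:
  assumes h: "h \<in> holder3 T B nrm \<gamma>" and \<gamma>: "0 < \<gamma>" and T: "0 < T"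
    and ord: "0 \<le> s" "s \<le> u" "u \<le> t" "t \<le> T"
  shows "nrm (h [t, u, s]) \<le> norm3 T B nrm \<gamma> h * (t - s) powr \<gamma>"
proof -
  have hc: "h \<in> cont_increments T B nrm 3"
    using h by (simp add: holder3_def)
  define l where "l n = 1 / real (n + 2)" for n
  have l: "0 < l n" "l n < 1" for n by (auto simp: l_def)
  have l0: "l \<longlonglongrightarrow> 0"
    using LIMSEQ_ignore_initial_segment[OF lim_1_over_n, of 2] by (simp add: l_def[abs_def])
  define t' u' s' where "t' n = t + l n * (T - t)" and "u' n = u + l n * (T / 2 - u)"
    and "s' n = s + l n * (0 - s)" for n
  have lims: "t' \<longlonglongrightarrow> t" "u' \<longlonglongrightarrow> u" "s' \<longlonglongrightarrow> s"
    unfolding t'_def[abs_def] u'_def[abs_def] s'_def[abs_def]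
    by (auto intro!: tendsto_eq_intros l0)
  have ord': "0 \<le> s' n" "s' n < u' n" "u' n < t' n" "t' n \<le> T" for n
  proof -
    have "s' n = (1 - l n) * s" "u' n = (1 - l n) * u + l n * (T / 2)" "t' n = (1 - l n) * t + l n * T"
      by (simp_all add: s'_def u'_def t'_def algebra_simps)
    moreover have "(1 - l n) * s \<le> (1 - l n) * u" "(1 - l n) * u \<le> (1 - l n) * t"
      "(1 - l n) * t \<le> (1 - l n) * T" "0 \<le> (1 - l n) * s" "0 < l n * (T / 2)" "l n * T = 2 * (l n * (T / 2))"
      using l[of n] ord T by (auto intro!: mult_left_mono)
    moreover have "(1 - l n) * T + l n * T = T"
      by (simp add: algebra_simps)
    ultimately show "0 \<le> s' n" "s' n < u' n" "u' n < t' n" "t' n \<le> T"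
      by linarith+
  qed
  have le': "s' n \<le> u' n" "u' n \<le> t' n" "s' n < t' n" for n
    using ord'[of n] by linarith+
  have mem: "[t, u, s] \<in> simplex_T T 3" "[t' n, u' n, s' n] \<in> simplex_T T 3" for n
    using ord ord' le' by simp_all
  have "(\<lambda>n. nrm (h [t' n, u' n, s' n] - h [t, u, s])) \<longlonglongrightarrow> 0"
    using lims by (intro cont_increments_tendsto[OF hc] mem) (auto simp: less_Suc_eq numeral_3_eq_3)
  then have "(\<lambda>n. nrm (h [t' n, u' n, s' n])) \<longlonglongrightarrow> nrm (h [t, u, s])"
    by (intro tendsto_nrm cont_increments_mem[OF hc] mem)
  moreover have "(\<lambda>n. norm3 T B nrm \<gamma> h * (t' n - s' n) powr \<gamma>)
      \<longlonglongrightarrow> norm3 T B nrm \<gamma> h * (t - s) powr \<gamma>"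
    using \<gamma> le'(3) lims by (intro tendsto_intros tendsto_powr') (auto intro!: always_eventually intro: less_imp_le)
  ultimately show ?thesis
    using norm3_bound_strict[OF h ord'] by (intro LIMSEQ_le) auto
qed

end


section \<open>Strongly continuous semigroups on a bounded time interval\<close>

locale semigroup_on = banach_on B nrm
  for B :: "'a::real_vector set" and nrm :: "'a \<Rightarrow> real" +
  fixes S :: "real \<Rightarrow> 'a \<Rightarrow> 'a" and T :: real
  assumes semigroup: "strongly_continuous_semigroup_on B nrm S" and T_pos: "0 < T"
begin

lemma S_operator: "0 \<le> t \<Longrightarrow> bounded_operator_on B nrm (S t)"
  and S_0 [simp]: "x \<in> B \<Longrightarrow> S 0 x = x"
  and S_plus: "0 \<le> s \<Longrightarrow> 0 \<le> t \<Longrightarrow> x \<in> B \<Longrightarrow> S (s + t) x = S s (S t x)"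
  and S_tendsto: "x \<in> B \<Longrightarrow> 0 \<le> t \<Longrightarrow> ((\<lambda>r. nrm (S r x - S t x)) \<longlongrightarrow> 0) (at t within {0..})"
  using semigroup unfolding strongly_continuous_semigroup_on_def by auto

lemma S_mem [simp]: "0 \<le> t \<Longrightarrow> x \<in> B \<Longrightarrow> S t x \<in> B"
  by (rule bounded_operator_mem[OF S_operator])

lemma S_add: "0 \<le> t \<Longrightarrow> x \<in> B \<Longrightarrow> y \<in> B \<Longrightarrow> S t (x + y) = S t x + S t y"
  by (rule bounded_operator_add[OF S_operator])

lemma S_diff: "0 \<le> t \<Longrightarrow> x \<in> B \<Longrightarrow> y \<in> B \<Longrightarrow> S t (x - y) = S t x - S t y"
  by (rule bounded_operator_diff[OF S_operator])

lemma S_lin: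
  "0 \<le> t \<Longrightarrow> x \<in> B \<Longrightarrow> y \<in> B \<Longrightarrow> S t (a *\<^sub>R x + b *\<^sub>R y) = a *\<^sub>R S t x + b *\<^sub>R S t y"
  by (rule bounded_operator_lin[OF S_operator])

lemma S_zero [simp]: "0 \<le> t \<Longrightarrow> S t 0 = 0"
  using S_diff[of t 0 0] by simp

lemma S_continuous:
  assumes "x \<in> B" "0 \<le> t" "e > 0"
  obtains d where "d > 0" "\<And>r. 0 \<le> r \<Longrightarrow> \<bar>r - t\<bar> < d \<Longrightarrow> nrm (S r x - S t x) < e"
proof -
  have "\<forall>\<^sub>F r in at t within {0..}. nrm (S r x - S t x) < e"
    by (rule order_tendstoD(2)[OF S_tendsto]) (use assms in auto)
  then obtain d where "d > 0"
    "\<And>r. r \<in> {0..} \<Longrightarrow> r \<noteq> t \<Longrightarrow> dist r t < d \<Longrightarrow> nrm (S r x - S t x) < e"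
    unfolding eventually_at by blast
  then show ?thesis
    using assms that[of d] by (metis atLeast_iff diff_self dist_real_def nrm_zero)
qed

text \<open>Orbits are continuous, hence bounded on [0, T], and uniform boundedness applies.\<close>

lemma S_uniformly_bounded: "\<exists>M\<ge>1. \<forall>t\<in>{0..T}. \<forall>x\<in>B. nrm (S t x) \<le> M * nrm x"
proof (rule uniform_boundedness)
  fix x assume x: "x \<in> B"
  have "continuous_on {0..T} (\<lambda>t. nrm (S t x))"
    unfolding continuous_on_def
  proof
    fix t assume t: "t \<in> {0..T}"
    have "((\<lambda>r. nrm (S r x - S t x)) \<longlongrightarrow> 0) (at t within {0..T})"
      using tendsto_within_subset[OF S_tendsto[OF x]] t by auto
    moreover have "\<forall>\<^sub>F r in at t within {0..T}. norm (nrm (S r x) - nrm (S t x)) \<le> nrm (S r x - S t x)"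
      unfolding eventually_at_filter
    proof (intro always_eventually allI impI)
      fix r assume "r \<in> {0..T}"
      then show "norm (nrm (S r x) - nrm (S t x)) \<le> nrm (S r x - S t x)"
        using t x nrm_le_add_diff[of "S r x" "S t x"] nrm_le_add_diff[of "S t x" "S r x"]
          nrm_diff_commute[of "S t x" "S r x"] by auto
    qed
    ultimately have "((\<lambda>r. nrm (S r x) - nrm (S t x)) \<longlongrightarrow> 0) (at t within {0..T})"
      by (rule Lim_null_comparison[rotated])
    then show "((\<lambda>r. nrm (S r x)) \<longlongrightarrow> nrm (S t x)) (at t within {0..T})"
      by (rule LIM_zero_cancel)
  qed
  then have "bounded ((\<lambda>t. nrm (S t x)) ` {0..T})"
    by (intro compact_imp_bounded compact_continuous_image) auto
  then obtain C where "\<forall>t\<in>{0..T}. \<bar>nrm (S t x)\<bar> \<le> C"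
    unfolding bounded_real by auto
  then show "\<exists>C. \<forall>t\<in>{0..T}. nrm (S t x) \<le> C"
    by (intro exI[of _ C]) (auto simp: abs_le_iff)
qed (auto intro: S_operator)

end


section \<open>The dyadic grid\<close>

definition dyad :: "real \<Rightarrow> nat \<Rightarrow> nat \<Rightarrow> real" where
  "dyad T n k = real k * T / 2 ^ n"

lemma dyad_0 [simp]: "dyad T n 0 = 0"
  by (simp add: dyad_def)

lemma dyad_top [simp]: "dyad T n (2 ^ n) = T"
  by (simp add: dyad_def)

lemma dyad_refine: "dyad T (n + k) (p * 2 ^ k) = dyad T n p"
  by (simp add: dyad_def power_add)

lemma dyad_double [simp]: "dyad T (Suc n) (2 * p) = dyad T n p"
  using dyad_refine[of T n 1 p] by (simp add: mult.commute)

lemma dyad_double_Suc [simp]: "dyad T (Suc n) (Suc (Suc (2 * p))) = dyad T n (Suc p)"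
  using dyad_double[of T n "Suc p"] by simp

lemma dyad_diff: "dyad T n (p + q) - dyad T n p = real q * (T / 2 ^ n)"
  by (simp add: dyad_def field_simps)

lemma dyad_Suc_diff [simp]: "dyad T n (Suc p) - dyad T n p = T / 2 ^ n"
  using dyad_diff[of T n p 1] by simp

lemma dyad_mono: "0 < T \<Longrightarrow> i \<le> j \<Longrightarrow> dyad T n i \<le> dyad T n j"
  by (simp add: dyad_def divide_right_mono mult_right_mono)

lemma dyad_inject: "0 < T \<Longrightarrow> dyad T n i = dyad T n j \<longleftrightarrow> i = j"
  by (simp add: dyad_def)

lemma dyad_nonneg: "0 < T \<Longrightarrow> 0 \<le> dyad T n i"
  by (simp add: dyad_def)

lemma dyad_le: "0 < T \<Longrightarrow> p \<le> 2 ^ n \<Longrightarrow> dyad T n p \<le> T"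
  using dyad_mono[of T p "2 ^ n" n] by simp

lemma dyadic_level_iff: "t \<in> dyadic_level T n \<longleftrightarrow> (\<exists>k\<le>2 ^ n. t = dyad T n k)"
  by (auto simp: dyadic_level_def dyad_def)

lemma dyadic_level_mono:
  assumes "m \<le> n" shows "dyadic_level T m \<subseteq> dyadic_level T n"
proof
  fix t assume "t \<in> dyadic_level T m"
  then obtain k where k: "k \<le> 2 ^ m" "t = dyad T m k"
    by (auto simp: dyadic_level_iff)
  have "k * 2 ^ (n - m) \<le> 2 ^ m * 2 ^ (n - m)"
    using k(1) by simp
  then have "k * 2 ^ (n - m) \<le> 2 ^ n"
    using assms by (simp flip: power_add)
  moreover have "t = dyad T n (k * 2 ^ (n - m))"
    using dyad_refine[of T m "n - m" k] k(2) assms by simp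
  ultimately show "t \<in> dyadic_level T n"
    by (auto simp: dyadic_level_iff)
qed

lemma dyad_in_dyadics: "k \<le> 2 ^ n \<Longrightarrow> dyad T n k \<in> dyadics T"
  by (auto simp: dyadics_def dyadic_level_iff)

lemma dyadics_range: "0 < T \<Longrightarrow> t \<in> dyadics T \<Longrightarrow> 0 \<le> t \<and> t \<le> T"
  by (auto simp: dyadics_def dyadic_level_iff intro: dyad_nonneg dyad_le)

lemma dyadics_0: "0 \<in> dyadics T"
  using dyad_in_dyadics[of 0 0 T] by simp

lemma dyadic_intervals_iff:
  "(a, c) \<in> dyadic_intervals T \<longleftrightarrow> (\<exists>n k. k < 2 ^ n \<and> a = dyad T n k \<and> c = dyad T n (Suc k))"
  by (auto simp: dyadic_intervals_def dyad_def)

lemma odd_dyad_notin_level: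
  assumes "0 < T" shows "dyad T (Suc n) (Suc (2 * k)) \<notin> dyadic_level T n"
proof
  assume "dyad T (Suc n) (Suc (2 * k)) \<in> dyadic_level T n"
  then obtain j where "dyad T (Suc n) (Suc (2 * k)) = dyad T (Suc n) (2 * j)"
    by (auto simp: dyadic_level_iff)
  then have "Suc (2 * k) = 2 * j"
    using dyad_inject[OF assms] by blast
  then show False by presburger
qed

lemma dyadics_common_level:
  assumes "s \<in> dyadics T" "t \<in> dyadics T"
  obtains m i j where "m \<ge> n" "i \<le> 2 ^ m" "j \<le> 2 ^ m" "s = dyad T m i" "t = dyad T m j"
proof -
  obtain n1 n2 where "s \<in> dyadic_level T n1" "t \<in> dyadic_level T n2"
    using assms by (auto simp: dyadics_def)
  moreover have "n1 \<le> max n (max n1 n2)" "n2 \<le> max n (max n1 n2)"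
    by auto
  ultimately have "s \<in> dyadic_level T (max n (max n1 n2))" "t \<in> dyadic_level T (max n (max n1 n2))"
    using dyadic_level_mono by blast+
  then show ?thesis
    using that[of "max n (max n1 n2)"] by (auto simp: dyadic_level_iff)
qed

lemma dyadics_dense:
  assumes T: "0 < T"
  shows "{0..T} \<subseteq> closure (dyadics T)"
proof
  fix t assume t: "t \<in> {0..T}"
  define k where "k n = nat \<lfloor>t / T * 2 ^ n\<rfloor>" for n :: nat
  have k: "real (k n) \<le> t / T * 2 ^ n" "t / T * 2 ^ n < real (k n) + 1" for n
    using t T by (auto simp: k_def)
  have le: "dyad T n (k n) \<le> t" for n
    using k(1)[of n] T by (simp add: dyad_def field_simps)
  have gt: "t - T * (1 / 2) ^ n < dyad T n (k n)" for n
  proof -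
    have "t < (real (k n) + 1) * T / 2 ^ n"
      using k(2)[of n] T by (simp add: field_simps)
    also have "\<dots> = dyad T n (k n) + T * (1 / 2) ^ n"
      by (simp add: dyad_def power_one_over add_divide_distrib distrib_right)
    finally show ?thesis by simp
  qed
  have "k n \<le> 2 ^ n" for n
  proof -
    have "t / T * 2 ^ n \<le> 1 * 2 ^ n"
      using t T by (intro mult_right_mono) auto
    then have "real (k n) \<le> 2 ^ n" using k(1)[of n] by linarith
    then show ?thesis by simp
  qed
  then have "dyad T n (k n) \<in> dyadics T" for n
    by (rule dyad_in_dyadics)
  moreover have "(\<lambda>n. dyad T n (k n)) \<longlonglongrightarrow> t"
  proof (rule tendsto_sandwich[of "\<lambda>n. t - T * (1 / 2) ^ n" _ _ "\<lambda>_. t"])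
    have "(\<lambda>n. t - T * (1 / 2) ^ n) \<longlonglongrightarrow> t - T * 0"
      by (intro tendsto_intros LIMSEQ_power_zero) auto
    then show "(\<lambda>n. t - T * (1 / 2) ^ n) \<longlonglongrightarrow> t" by simp
  qed (use le gt in \<open>auto intro: less_imp_le always_eventually\<close>)
  ultimately show "t \<in> closure (dyadics T)"
    unfolding closure_sequential by (auto intro!: exI[of _ "\<lambda>n. dyad T n (k n)"])
qed


section \<open>Algebra of the dyadic recursion\<close>

lemma path_level_stable:
  assumes "t \<in> dyadic_level T m" "m \<le> n"
  shows "path_level S T sp H n t = path_level S T sp H m t"
  using assms(2)
proof (induction n rule: dec_induct)
  case (step n)
  then have "t \<in> dyadic_level T n"
    using assms(1) dyadic_level_mono by blast
  then show ?case
    using step.IH by simp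
qed simp

lemma dyadic_path_level:
  assumes "t \<in> dyadic_level T n"
  shows "dyadic_path S T sp H t = path_level S T sp H n t"
  unfolding dyadic_path_def
  by (rule path_level_stable[symmetric]) (use assms in \<open>auto intro: LeastI Least_le\<close>)

locale defect = semigroup_on B nrm S T
  for B :: "'a::real_vector set" and nrm :: "'a \<Rightarrow> real" and S T +
  fixes \<gamma> :: real and H :: "real list \<Rightarrow> 'a"
  assumes \<gamma>_pos: "0 < \<gamma>" and H_Z: "H \<in> Z_holder3 T B nrm S \<gamma>"
begin

abbreviation N :: real where "N \<equiv> norm3 T B nrm \<gamma> H"

lemma N_nonneg [simp]: "0 \<le> N"
  by (simp add: norm3_def)

lemma H_holder: "H \<in> holder3 T B nrm \<gamma>"
  using H_Z by (simp add: Z_holder3_def)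

lemma H_cont: "H \<in> cont_increments T B nrm 3"
  using H_holder by (simp add: holder3_def)

lemma H_mem: "0 \<le> s \<Longrightarrow> s \<le> u \<Longrightarrow> u \<le> t \<Longrightarrow> t \<le> T \<Longrightarrow> H [t, u, s] \<in> B"
  by (rule cont_increments_mem[OF H_cont]) simp

lemma H_bound: "0 \<le> s \<Longrightarrow> s \<le> u \<Longrightarrow> u \<le> t \<Longrightarrow> t \<le> T \<Longrightarrow> nrm (H [t, u, s]) \<le> N * (t - s) powr \<gamma>"
  by (rule norm3_bound[OF H_holder \<gamma>_pos T_pos])

lemma H_cocycle:
  assumes "0 \<le> r" "r \<le> s" "s \<le> u" "u \<le> t" "t \<le> T"
  shows "H [t, s, r] - H [t, u, r] + H [t, u, s] - S (t - u) (H [u, s, r]) = 0"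
proof -
  have "[t, u, s, r] \<in> simplex_T T 4"
    using assms by simp
  then have "hat_delta S H [t, u, s, r] = 0"
    using H_Z unfolding Z_holder3_def by blast
  then show ?thesis
    by (simp only: hat_delta_3)
qed

text \<open>
  The cocycle equation at (t, t, t, s) identifies \<open>H [t, t, s]\<close> with \<open>H [t, t, t]\<close>, which the
  bound by \<open>(t - t) powr \<gamma> = 0\<close> annihilates.
\<close>

lemma H_diag:
  assumes "0 \<le> s" "s \<le> t" "t \<le> T"
  shows "H [t, t, s] = 0"
proof -
  have mem: "H [t, t, t] \<in> B" "H [t, t, s] \<in> B"
    using assms by (auto intro: H_mem)
  have "nrm (H [t, t, t]) \<le> 0"
    using H_bound[of t t t] assms by simp
  then have "nrm (H [t, t, t]) = 0"
    using nrm_nonneg[OF mem(1)] by linarith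
  then have "H [t, t, t] = 0"
    using nrm_eq_0[OF mem(1)] by blast
  moreover have "H [t, t, s] - H [t, t, s] + H [t, t, t] - S (t - t) (H [t, t, s]) = 0"
    using assms by (intro H_cocycle) auto
  ultimately show ?thesis
    using mem by simp
qed

lemma germ_mem: "0 \<le> s \<Longrightarrow> s \<le> t \<Longrightarrow> t \<le> T \<Longrightarrow> germ H t s \<in> B"
  by (simp add: germ_def H_mem)

lemma germ_diag: "0 \<le> t \<Longrightarrow> t \<le> T \<Longrightarrow> germ H t t = 0"
  by (simp add: germ_def H_diag)

lemma germ_0:
  assumes "0 \<le> t" "t \<le> T"
  shows "germ H t 0 = 0"
proof -
  have "H [t, 0, 0] - H [t, 0, 0] + H [t, 0, 0] - S (t - 0) (H [0, 0, 0]) = 0"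
    using assms by (intro H_cocycle) auto
  then show ?thesis
    using assms T_pos by (simp add: germ_def H_diag)
qed

text \<open>The germ is a preimage of H: this is the cocycle equation at (t, u, s, 0).\<close>

lemma germ_increment:
  assumes "0 \<le> s" "s \<le> u" "u \<le> t" "t \<le> T"
  shows "germ H t s = germ H t u + S (t - u) (germ H u s) + H [t, u, s]"
proof -
  have "S (t - u) (- H [u, s, 0]) = - S (t - u) (H [u, s, 0])"
    using S_diff[of "t - u" 0 "H [u, s, 0]"] assms by (simp add: H_mem)
  then show ?thesis
    using H_cocycle[of 0 s u t] assms by (simp add: germ_def algebra_simps)
qed

text \<open>
  By the semigroup law the terms \<open>- x t + S (t - s) (x s)\<close> cancel in the reduced increment, whatever
  the path x is, and only the reduced increment of the germ is left.
\<close>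

lemma remainder_increment:
  assumes "0 \<le> s" "s \<le> u" "u \<le> t" "t \<le> T" and x: "x s \<in> B" "x u \<in> B"
  shows "germ H t s - x t + S (t - s) (x s)
    = (germ H t u - x t + S (t - u) (x u)) + S (t - u) (germ H u s - x u + S (u - s) (x s)) + H [t, u, s]"
proof -
  have "S (t - u) (S (u - s) (x s)) = S (t - s) (x s)"
    using S_plus[of "t - u" "u - s" "x s"] assms by simp
  moreover have "S (t - u) (germ H u s - x u + S (u - s) (x s))
      = S (t - u) (germ H u s) - S (t - u) (x u) + S (t - u) (S (u - s) (x s))"
    using assms germ_mem[of s u] by (simp add: S_add S_diff)
  ultimately show ?thesis
    using germ_increment[OF assms(1-4)] by simp
qed

end

locale dyadic_recursion = defect B nrm S T \<gamma> H
  for B :: "'a::real_vector set" and nrm S T \<gamma> H +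
  fixes sp :: "'a splitting"
  assumes splitting: "splitting_rule T B S sp H"
begin

abbreviation I :: "real \<Rightarrow> 'a" where "I \<equiv> dyadic_path S T sp H"
abbreviation R :: "real \<Rightarrow> real \<Rightarrow> 'a" where "R \<equiv> residual S T sp H"

lemma path_0: "I 0 = 0"
proof -
  have "0 \<in> dyadic_level T 0"
    unfolding dyadic_level_iff by (intro exI[of _ 0]) simp
  then show ?thesis
    using T_pos by (simp add: dyadic_path_level)
qed

lemma path_T: "I T = germ H T 0"
proof -
  have "T \<in> dyadic_level T 0"
    unfolding dyadic_level_iff by (intro exI[of _ 1]) (simp add: dyad_def)
  then show ?thesis
    by (simp add: dyadic_path_level)
qed

lemma path_midpoint:
  fixes n k
  defines "a \<equiv> dyad T n k" and "b \<equiv> dyad T (Suc n) (Suc (2 * k))" and "c \<equiv> dyad T n (Suc k)"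
  assumes k: "k < 2 ^ n"
  shows "I b = germ H b a + S (b - a) (I a) - snd (sp a c (R c a))"
proof -
  have ba: "b - T / 2 ^ Suc n = a" and bc: "b + T / 2 ^ Suc n = c"
    by (simp_all add: a_def b_def c_def dyad_def field_simps)
  have "Suc (2 * k) \<le> 2 ^ Suc n"
    using k by simp
  then have "b \<in> dyadic_level T (Suc n)"
    unfolding b_def dyadic_level_iff by blast
  moreover have "b \<notin> dyadic_level T n"
    unfolding b_def using odd_dyad_notin_level[OF T_pos] .
  moreover have "a \<in> dyadic_level T n" "c \<in> dyadic_level T n"
    unfolding a_def c_def dyadic_level_iff using k by (auto intro: less_imp_le Suc_leI)
  ultimately show ?thesis
    by (simp add: dyadic_path_level[where n = n] dyadic_path_level[where n = "Suc n"]
        ba[simplified] bc[simplified] Let_def residual_def)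
qed

lemma splitting_dyad:
  fixes n k
  defines "a \<equiv> dyad T n k" and "b \<equiv> dyad T (Suc n) (Suc (2 * k))" and "c \<equiv> dyad T n (Suc k)"
  assumes k: "k < 2 ^ n"
  shows "fst (sp a c (R c a)) \<in> B" "snd (sp a c (R c a)) \<in> B"
    "R c a = fst (sp a c (R c a)) + S (c - b) (snd (sp a c (R c a))) + H [c, b, a]"
proof -
  have "(a, c) \<in> dyadic_intervals T"
    unfolding a_def c_def dyadic_intervals_iff using k by blast
  moreover have "(a + c) / 2 = b"
    by (simp add: a_def b_def c_def dyad_def field_simps)
  ultimately show "fst (sp a c (R c a)) \<in> B" "snd (sp a c (R c a)) \<in> B"
    "R c a = fst (sp a c (R c a)) + S (c - b) (snd (sp a c (R c a))) + H [c, b, a]"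
    using splitting by (auto simp: splitting_rule_def Let_def)
qed

lemma path_dyad_mem: "k \<le> 2 ^ n \<Longrightarrow> I (dyad T n k) \<in> B"
proof (induction n arbitrary: k)
  case 0
  then consider "k = 0" | "k = 1" by fastforce
  then show ?case
    using T_pos by cases (auto simp: path_0 path_T dyad_def germ_mem)
next
  case (Suc n)
  show ?case
  proof (cases "even k")
    case True
    then obtain j where "k = 2 * j" by blast
    then show ?thesis using Suc by simp
  next
    case False
    then obtain j where k: "k = Suc (2 * j)"
      using oddE by fastforce
    then have j: "j < 2 ^ n" using Suc.prems by simp
    have "dyad T n j \<le> dyad T (Suc n) k"
      using dyad_mono[OF T_pos, of "2 * j" k "Suc n"] k by simp
    then show ?thesis
      using Suc.IH[of j] j splitting_dyad(2)[OF j] Suc.prems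
      unfolding k path_midpoint[OF j]
      by (auto intro!: diff_mem add_mem S_mem germ_mem dyad_nonneg dyad_le T_pos)
  qed
qed

lemma path_mem: "t \<in> dyadics T \<Longrightarrow> I t \<in> B"
  by (auto simp: dyadics_def dyadic_level_iff path_dyad_mem)

lemma residual_mem: "s \<in> dyadics T \<Longrightarrow> t \<in> dyadics T \<Longrightarrow> s \<le> t \<Longrightarrow> R t s \<in> B"
  using dyadics_range[OF T_pos] by (simp add: residual_def germ_mem path_mem)

lemma residual_diag: "t \<in> dyadics T \<Longrightarrow> R t t = 0"
  using dyadics_range[OF T_pos] by (simp add: residual_def germ_diag path_mem)

lemma residual_increment:
  assumes "s \<in> dyadics T" "u \<in> dyadics T" "t \<in> dyadics T" "s \<le> u" "u \<le> t"
  shows "R t s = R t u + S (t - u) (R u s) + H [t, u, s]"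
  unfolding residual_def using assms dyadics_range[OF T_pos] path_mem
  by (intro remainder_increment) auto

lemma residual_root: "R T 0 = 0"
  using T_pos by (simp add: residual_def path_0 path_T)

text \<open>
  The path value at a midpoint is chosen so that the residual of the left half is the second child;
  the splitting equation then forces the residual of the right half to be the first child.
\<close>

lemma residual_children:
  fixes n k
  defines "a \<equiv> dyad T n k" and "b \<equiv> dyad T (Suc n) (Suc (2 * k))" and "c \<equiv> dyad T n (Suc k)"
  assumes k: "k < 2 ^ n"
  shows "R b a = snd (sp a c (R c a))" "R c b = fst (sp a c (R c a))"
proof -
  have D: "a \<in> dyadics T" "b \<in> dyadics T" "c \<in> dyadics T"
    unfolding a_def b_def c_def using k by (auto intro!: dyad_in_dyadics)
  have le: "a \<le> b" "b \<le> c"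
    using dyad_mono[OF T_pos, of "2 * k" "Suc (2 * k)" "Suc n"]
      dyad_mono[OF T_pos, of "Suc (2 * k)" "Suc (Suc (2 * k))" "Suc n"]
    by (simp_all add: a_def b_def c_def)
  show left: "R b a = snd (sp a c (R c a))"
    unfolding residual_def[of S T sp H b a] using path_midpoint[OF k]
    by (simp add: a_def b_def c_def)
  show "R c b = fst (sp a c (R c a))"
    using residual_increment[OF D le] splitting_dyad(3)[OF k] left
    by (simp add: a_def b_def c_def)
qed

end


section \<open>The Hoelder bound on dyadic pairs\<close>

lemma powr_half: "0 \<le> x \<Longrightarrow> (x / 2) powr g = 2 powr (- g) * x powr (g::real)"
  by (simp add: powr_divide powr_minus_divide)

locale admissible_recursion = dyadic_recursion B nrm S T \<gamma> H sp
  for B :: "'a::real_vector set" and nrm S T \<gamma> H sp +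
  fixes \<theta> C_H M :: real
  assumes admissible: "subcritical_admissible T nrm S \<gamma> \<theta> C_H sp H"
    and M_ge_1: "1 \<le> M"
    and S_bound: "\<And>t x. 0 \<le> t \<Longrightarrow> t \<le> T \<Longrightarrow> x \<in> B \<Longrightarrow> nrm (S t x) \<le> M * nrm x"
begin

text \<open>
  The constants of the estimate: \<open>K * C_H\<close> bounds the residuals on dyadic intervals relative to
  the rate, the power \<open>\<gamma>\<close> of the length; P is the cost of splitting off one dyadic interval, and W is the sum of
  these costs over all levels, a geometric series of ratio \<open>2 powr (- \<gamma>)\<close>.
\<close>

definition K :: real where "K = 1 / (2 powr (- \<gamma>) - \<theta>)"

definition P :: real where "P = M * (K * C_H + N)"

definition W :: real where "W = P / (1 - 2 powr (- \<gamma>))"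

definition rate :: "nat \<Rightarrow> real" where "rate n = (T / 2 ^ n) powr \<gamma>"

lemma rate_nonneg [simp]: "0 \<le> rate n"
  by (simp add: rate_def)

lemma \<theta>: "0 \<le> \<theta>" "\<theta> < 2 powr (- \<gamma>)" and C_H_nonneg: "0 \<le> C_H"
  using admissible by (auto simp: subcritical_admissible_def)

lemma ratio: "0 < 2 powr (- \<gamma>)" "2 powr (- \<gamma>) < 1"
  using \<gamma>_pos by (simp_all add: powr_minus_divide)

lemma K_pos: "0 < K"
  using \<theta> by (simp add: K_def)

lemma K_fixed: "\<theta> * K + 1 = 2 powr (- \<gamma>) * K"
proof -
  have "(2 powr (- \<gamma>) - \<theta>) * K = 1"
    using \<theta> by (simp add: K_def)
  then show ?thesis by (simp add: algebra_simps)
qed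

lemma P: "M * N + M * (K * C_H) = P" "M * N \<le> P" "0 \<le> P"
proof -
  show sum: "M * N + M * (K * C_H) = P"
    by (simp add: P_def algebra_simps)
  have "0 \<le> M * (K * C_H)" "0 \<le> M * N"
    using M_ge_1 K_pos C_H_nonneg by simp_all
  then show "M * N \<le> P" "0 \<le> P"
    using sum by linarith+
qed

lemma W_fixed: "W * 2 powr (- \<gamma>) + P = W"
proof -
  have "1 - 2 powr (- \<gamma>) \<noteq> 0"
    using ratio(2) by linarith
  then have "W * (1 - 2 powr (- \<gamma>)) = P"
    using nonzero_eq_divide_eq W_def by blast
  then show ?thesis by (simp add: algebra_simps)
qed

lemma W_ge: "P \<le> W" "0 \<le> W"
proof -
  show "0 \<le> W"
    unfolding W_def using ratio P(3) by (intro divide_nonneg_nonneg) linarith+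
  then show "P \<le> W"
    using W_fixed mult_nonneg_nonneg[of W "2 powr (- \<gamma>)"] ratio by linarith
qed

lemma rate_Suc: "rate (Suc n) = 2 powr (- \<gamma>) * rate n"
  using powr_half[of "T / 2 ^ n" \<gamma>] T_pos by (simp add: rate_def field_simps)

lemma rate_Suc_le: "rate (Suc n) \<le> rate n"
  using ratio mult_right_mono[of "2 powr (- \<gamma>)" 1 "rate n"] by (simp add: rate_Suc)

text \<open>
  If the residuals of one level are at most \<open>x * C_H\<close> times its rate, those of the next are at most
  \<open>2 powr \<gamma> * (\<theta> * x + 1) * C_H\<close> times theirs. The map from x to the new factor is a contraction
  exactly when \<open>\<theta> < 2 powr (- \<gamma>)\<close>; K is its fixed point, and the recursion starts below it
  because the root residual is zero.
\<close>

lemma level_bound: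
  assumes "k < 2 ^ n"
  shows "nrm (R (dyad T n (Suc k)) (dyad T n k)) \<le> K * C_H * rate n"
  using assms
proof (induction n arbitrary: k)
  case 0
  then show ?case
    using K_pos C_H_nonneg residual_root by (simp add: dyad_def)
next
  case (Suc n)
  define j where "j = k div 2"
  have j: "j < 2 ^ n"
    using Suc.prems by (simp add: j_def less_mult_imp_div_less mult.commute)
  let ?Q = "R (dyad T n (Suc j)) (dyad T n j)"
  let ?p = "sp (dyad T n j) (dyad T n (Suc j)) ?Q"
  have "(dyad T n j, dyad T n (Suc j)) \<in> dyadic_intervals T"
    using j by (auto simp: dyadic_intervals_iff)
  then have "max (nrm (fst ?p)) (nrm (snd ?p)) \<le> \<theta> * nrm ?Q + C_H * rate n"
    using admissible by (auto simp: subcritical_admissible_def Let_def rate_def simp del: max.bounded_iff)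
  also have "\<dots> \<le> \<theta> * (K * C_H * rate n) + C_H * rate n"
    using Suc.IH[OF j] \<theta>(1) by (intro add_right_mono mult_left_mono)
  also have "\<dots> = (\<theta> * K + 1) * (C_H * rate n)"
    by (simp add: algebra_simps)
  also have "\<dots> = K * C_H * rate (Suc n)"
    unfolding K_fixed rate_Suc by (simp add: algebra_simps)
  finally have "nrm (fst ?p) \<le> K * C_H * rate (Suc n)" "nrm (snd ?p) \<le> K * C_H * rate (Suc n)"
    by simp_all
  moreover have "k = 2 * j \<or> k = Suc (2 * j)"
    unfolding j_def by presburger
  ultimately show ?case
    using residual_children[OF j] by auto
qed

lemma shifted_level_bound:
  assumes "k < 2 ^ n" "0 \<le> \<tau>" "\<tau> \<le> T"
  shows "nrm (S \<tau> (R (dyad T n (Suc k)) (dyad T n k))) \<le> M * (K * C_H) * rate n"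
proof -
  have "R (dyad T n (Suc k)) (dyad T n k) \<in> B"
    using assms(1) by (intro residual_mem dyad_in_dyadics dyad_mono T_pos) auto
  then have "nrm (S \<tau> (R (dyad T n (Suc k)) (dyad T n k))) \<le> M * nrm (R (dyad T n (Suc k)) (dyad T n k))"
    using assms(2,3) by (intro S_bound)
  also have "\<dots> \<le> M * (K * C_H * rate n)"
    using M_ge_1 by (intro mult_left_mono level_bound assms(1)) auto
  finally show ?thesis by (simp add: mult.assoc)
qed

text \<open>
  One step of a chain, with the estimate taken after a further time \<open>\<tau>\<close>; the shift \<open>\<tau> + (t - u)\<close>
  picked up by the earlier piece still ends before T.
\<close>

lemma shifted_increment_bound:
  assumes D: "s \<in> dyadics T" "u \<in> dyadics T" "t \<in> dyadics T"
    and le: "s \<le> u" "u \<le> t" "0 \<le> \<tau>" "\<tau> \<le> T - t" and L: "t - s \<le> L"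
  shows "nrm (S \<tau> (R t s)) \<le> nrm (S \<tau> (R t u)) + nrm (S (\<tau> + (t - u)) (R u s)) + M * N * L powr \<gamma>"
proof -
  have rng: "0 \<le> s" "t \<le> T"
    using D dyadics_range[OF T_pos] by auto
  have mem: "R t u \<in> B" "R u s \<in> B" "H [t, u, s] \<in> B"
    using D le rng by (auto intro: residual_mem H_mem)
  have "S \<tau> (R t s) = S \<tau> (R t u) + S (\<tau> + (t - u)) (R u s) + S \<tau> (H [t, u, s])"
    unfolding residual_increment[OF D le(1,2)] using mem le by (simp add: S_add S_plus)
  then have "nrm (S \<tau> (R t s)) \<le> nrm (S \<tau> (R t u)) + nrm (S (\<tau> + (t - u)) (R u s)) + nrm (S \<tau> (H [t, u, s]))"
    using nrm_triangle[of "S \<tau> (R t u)" "S (\<tau> + (t - u)) (R u s)"]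
      nrm_triangle[of "S \<tau> (R t u) + S (\<tau> + (t - u)) (R u s)" "S \<tau> (H [t, u, s])"] mem le by simp
  also have "nrm (S \<tau> (H [t, u, s])) \<le> M * nrm (H [t, u, s])"
    using mem le rng by (intro S_bound) auto
  also have "\<dots> \<le> M * (N * L powr \<gamma>)"
  proof (rule mult_left_mono)
    have "nrm (H [t, u, s]) \<le> N * (t - s) powr \<gamma>"
      using le rng by (intro H_bound) auto
    also have "\<dots> \<le> N * L powr \<gamma>"
      using le L \<gamma>_pos by (intro mult_left_mono powr_mono2) auto
    finally show "nrm (H [t, u, s]) \<le> N * L powr \<gamma>" .
  qed (use M_ge_1 in simp)
  finally show ?thesis by (simp add: mult.assoc)
qed

lemma chain_step: "W * rate (Suc n) + M * (K * C_H) * rate (Suc n) + M * N * rate n \<le> W * rate n"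
proof -
  have "0 \<le> M * (K * C_H)"
    using M_ge_1 K_pos C_H_nonneg by simp
  then have "M * (K * C_H) * rate (Suc n) \<le> M * (K * C_H) * rate n"
    by (intro mult_left_mono rate_Suc_le)
  moreover have "W * rate (Suc n) = W * 2 powr (- \<gamma>) * rate n"
    by (simp only: rate_Suc mult.assoc)
  moreover have "W * 2 powr (- \<gamma>) * rate n + (M * N * rate n + M * (K * C_H) * rate n) = W * rate n"
    by (simp only: distrib_right[symmetric] W_fixed P(1))
  ultimately show ?thesis
    by linarith
qed

text \<open>
  Each step of the chain halves the scale of what is left and splits off at most one dyadic interval,
  so that the rates sum geometrically. The semigroup is kept inside the estimate, with total time shift at most T:
  every term of the chain then meets the bound M once, whereas estimating step by step would
  accumulate powers of M.
\<close>

lemma chain_right: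
  assumes "q \<le> 2 ^ k" "p * 2 ^ k + q \<le> 2 ^ (n + k)"
    and "0 \<le> \<tau>" "\<tau> \<le> T - dyad T (n + k) (p * 2 ^ k + q)"
  shows "nrm (S \<tau> (R (dyad T (n + k) (p * 2 ^ k + q)) (dyad T n p))) \<le> W * rate n"
  using assms
proof (induction k arbitrary: n p q)
  case 0
  then consider "q = 0" | "q = 1" by fastforce
  then show ?case
  proof cases
    case 1
    then show ?thesis
      using 0 W_ge by (simp add: residual_diag dyad_in_dyadics)
  next
    case 2
    have "M * (K * C_H) \<le> W"
      using P(1) W_ge(1) M_ge_1 N_nonneg by (smt (verit) mult_nonneg_nonneg)
    then have "M * (K * C_H) * rate n \<le> W * rate n"
      by (intro mult_right_mono) auto
    then show ?thesis
      using shifted_level_bound[of p n \<tau>] 0 2 dyad_nonneg[OF T_pos, of n "Suc p"] by auto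
  qed
next
  case (Suc k)
  let ?t = "dyad T (n + Suc k) (p * 2 ^ Suc k + q)"
  show ?case
  proof (cases "q \<le> 2 ^ k")
    case True
    have "nrm (S \<tau> (R ?t (dyad T n p))) \<le> W * rate (Suc n)"
    proof -
      have eq: "2 * p * 2 ^ k = p * 2 ^ Suc k"
        by simp
      show ?thesis
        using Suc.IH[of q "2 * p" "Suc n", unfolded eq] True Suc.prems by simp
    qed
    also have "\<dots> \<le> W * rate n"
      by (intro mult_left_mono rate_Suc_le W_ge)
    finally show ?thesis .
  next
    case False
    let ?s = "dyad T n p" and ?u = "dyad T (Suc n) (Suc (2 * p))"
    have eq: "Suc (2 * p) * 2 ^ k + (q - 2 ^ k) = p * 2 ^ Suc k + q"
      using False by simp
    have "Suc (2 * p) * 2 ^ k \<le> 2 ^ Suc n * 2 ^ k"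
      using eq Suc.prems(2) by (simp add: power_add)
    then have p: "Suc (2 * p) \<le> 2 ^ Suc n"
      by (simp only: mult_le_cancel2) simp
    have D: "?s \<in> dyadics T" "?u \<in> dyadics T" "?t \<in> dyadics T"
      using p Suc.prems(2) by (auto intro!: dyad_in_dyadics)
    have su: "?s \<le> ?u"
      using dyad_mono[OF T_pos, of "2 * p" "Suc (2 * p)" "Suc n"] by simp
    have ut: "?u \<le> ?t"
      using dyad_mono[OF T_pos, of "Suc (2 * p) * 2 ^ k" "p * 2 ^ Suc k + q" "n + Suc k"] eq
        dyad_refine[of T "Suc n" k "Suc (2 * p)"] by simp
    have L: "?t - ?s \<le> T / 2 ^ n"
    proof -
      have "p * 2 ^ Suc k + q \<le> Suc p * 2 ^ Suc k" using Suc.prems(1) by simp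
      then have "?t \<le> dyad T n (Suc p)"
        using dyad_mono[OF T_pos] dyad_refine[of T n "Suc k" "Suc p"] by metis
      then show ?thesis using dyad_Suc_diff[of T n p] by linarith
    qed
    have "nrm (S \<tau> (R ?t ?s)) \<le> nrm (S \<tau> (R ?t ?u)) + nrm (S (\<tau> + (?t - ?u)) (R ?u ?s)) + M * N * rate n"
      unfolding rate_def using Suc.prems by (intro shifted_increment_bound D su ut L) auto
    also have "nrm (S \<tau> (R ?t ?u)) \<le> W * rate (Suc n)"
    proof -
      have "q - 2 ^ k \<le> 2 ^ k" using Suc.prems(1) by simp
      then show ?thesis
        using Suc.IH[of "q - 2 ^ k" "Suc (2 * p)" "Suc n"] Suc.prems unfolding eq by simp
    qed
    also have "nrm (S (\<tau> + (?t - ?u)) (R ?u ?s)) \<le> M * (K * C_H) * rate (Suc n)"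
      using shifted_level_bound[of "2 * p" "Suc n" "\<tau> + (?t - ?u)"] p ut Suc.prems
        dyad_nonneg[OF T_pos, of "Suc n" "Suc (2 * p)"] by simp
    finally show ?thesis
      using chain_step[of n] by linarith
  qed
qed

text \<open>The mirror image: a chain that ends at a point of level n.\<close>

lemma chain_left:
  assumes "q \<le> 2 ^ k" "p * 2 ^ k = r + q" "p \<le> 2 ^ n" "0 \<le> \<tau>" "\<tau> \<le> T - dyad T n p"
  shows "nrm (S \<tau> (R (dyad T n p) (dyad T (n + k) r))) \<le> W * rate n"
  using assms
proof (induction k arbitrary: n p q \<tau>)
  case 0
  then consider "p = r" | "p = Suc r" by fastforce
  then show ?case
  proof cases
    case 1
    then show ?thesis
      using 0 W_ge by (simp add: residual_diag dyad_in_dyadics)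
  next
    case 2
    have "M * (K * C_H) \<le> W"
      using P(1) W_ge(1) M_ge_1 N_nonneg by (smt (verit) mult_nonneg_nonneg)
    then have "M * (K * C_H) * rate n \<le> W * rate n"
      by (intro mult_right_mono) auto
    then show ?thesis
      using shifted_level_bound[of r n \<tau>] 0 2 dyad_nonneg[OF T_pos, of n "Suc r"] by auto
  qed
next
  case (Suc k)
  let ?s = "dyad T (n + Suc k) r"
  show ?case
  proof (cases "q \<le> 2 ^ k")
    case True
    have "nrm (S \<tau> (R (dyad T n p) ?s)) \<le> W * rate (Suc n)"
    proof -
      have "2 * p * 2 ^ k = r + q"
        using Suc.prems(2) by simp
      then show ?thesis
        using Suc.IH[of q "2 * p" "Suc n" \<tau>] True Suc.prems by simp
    qed
    also have "\<dots> \<le> W * rate n"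
      by (intro mult_left_mono rate_Suc_le W_ge)
    finally show ?thesis .
  next
    case False
    then have "p \<noteq> 0"
      using Suc.prems(2) by (intro notI) simp
    then obtain j where j: "p = Suc j"
      using not0_implies_Suc by blast
    let ?t = "dyad T n p" and ?u = "dyad T (Suc n) (Suc (2 * j))"
    have eq: "Suc (2 * j) * 2 ^ k = r + (q - 2 ^ k)"
      using False Suc.prems(2) by (simp add: j)
    have le: "Suc (2 * j) \<le> 2 ^ Suc n" "Suc (2 * j) < 2 ^ Suc n"
      using Suc.prems(3) by (auto simp: j)
    have "r \<le> p * 2 ^ Suc k"
      using Suc.prems(2) by simp
    also have "\<dots> \<le> 2 ^ n * 2 ^ Suc k"
      using Suc.prems(3) by (rule mult_right_mono) simp
    finally have r: "r \<le> 2 ^ (n + Suc k)"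
      by (simp add: power_add)
    have D: "?s \<in> dyadics T" "?u \<in> dyadics T" "?t \<in> dyadics T"
      using le r Suc.prems(3) by (auto intro!: dyad_in_dyadics)
    have ut: "?u \<le> ?t"
      using dyad_mono[OF T_pos, of "Suc (2 * j)" "Suc (Suc (2 * j))" "Suc n"] by (simp add: j)
    have su: "?s \<le> ?u"
      using dyad_mono[OF T_pos, of r "Suc (2 * j) * 2 ^ k" "n + Suc k"] eq
        dyad_refine[of T "Suc n" k "Suc (2 * j)"] by simp
    have L: "?t - ?s \<le> T / 2 ^ n"
    proof -
      have "j * 2 ^ Suc k \<le> r" using Suc.prems(1,2) by (simp add: j)
      then have "dyad T n j \<le> ?s"
        using dyad_mono[OF T_pos] dyad_refine[of T n "Suc k" j] by metis
      then show ?thesis using dyad_Suc_diff[of T n j] unfolding j by linarith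
    qed
    have "nrm (S \<tau> (R ?t ?s)) \<le> nrm (S \<tau> (R ?t ?u)) + nrm (S (\<tau> + (?t - ?u)) (R ?u ?s)) + M * N * rate n"
      unfolding rate_def using Suc.prems by (intro shifted_increment_bound D su ut L) auto
    also have "nrm (S (\<tau> + (?t - ?u)) (R ?u ?s)) \<le> W * rate (Suc n)"
    proof -
      have "q - 2 ^ k \<le> 2 ^ k" using Suc.prems(1) by simp
      then show ?thesis
        using Suc.IH[of "q - 2 ^ k" "Suc (2 * j)" "Suc n" "\<tau> + (?t - ?u)"] eq le ut Suc.prems by simp
    qed
    also have "nrm (S \<tau> (R ?t ?u)) \<le> M * (K * C_H) * rate (Suc n)"
      using shifted_level_bound[of "Suc (2 * j)" "Suc n" \<tau>] le Suc.prems
        dyad_nonneg[OF T_pos, of n p] by (simp add: j)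
    finally show ?thesis
      using chain_step[of n] by linarith
  qed
qed

text \<open>
  Choose the level n whose mesh satisfies \<open>T / 2 ^ n \<le> t - s \<le> 2 * T / 2 ^ n\<close>. The first grid
  point at or after s is closer than one mesh to s, and at most two meshes from t; if it is more
  than one mesh from t, the next grid point is inserted. This leaves a left chain, at most one full
  dyadic interval and a right chain.
\<close>

lemma dyadic_holder_bound:
  assumes D: "s \<in> dyadics T" "t \<in> dyadics T" and st: "s < t"
  shows "nrm (R t s) \<le> 5 * W * (t - s) powr \<gamma>"
proof -
  have rng: "0 \<le> s" "t \<le> T"
    using D dyadics_range[OF T_pos] by auto
  define n where "n = (LEAST n. T / 2 ^ n \<le> t - s)"
  have "\<exists>n. T / 2 ^ n \<le> t - s"
  proof -
    obtain n where "(1 / 2) ^ n < (t - s) / T"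
      using real_arch_pow_inv[of "(t - s) / T" "1 / 2"] st T_pos by auto
    then show ?thesis
      using T_pos by (intro exI[of _ n]) (simp add: field_simps power_one_over)
  qed
  then have n: "T / 2 ^ n \<le> t - s"
    unfolding n_def by (rule LeastI_ex)
  have n2: "t - s \<le> 2 * (T / 2 ^ n)"
  proof (cases n)
    case 0
    then show ?thesis using rng T_pos by simp
  next
    case (Suc m)
    then have "\<not> T / 2 ^ m \<le> t - s"
      using not_less_Least[of m "\<lambda>n. T / 2 ^ n \<le> t - s"] by (simp add: n_def)
    then show ?thesis using Suc by (simp add: field_simps)
  qed
  obtain m i j where "m \<ge> n" and i: "i \<le> 2 ^ m" and j: "j \<le> 2 ^ m"
    and s: "s = dyad T m i" and t: "t = dyad T m j"
    using dyadics_common_level[OF D] by metis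
  then obtain k where m: "m = n + k"
    using le_Suc_ex by blast
  have "i \<le> j"
    using st dyad_mono[OF T_pos, of j i m] by (fastforce simp: s t)
  then obtain d where d: "j = i + d"
    using le_Suc_ex by blast
  have ts: "t - s = real d * (T / 2 ^ m)"
    unfolding s t d by (rule dyad_diff)
  have mesh: "T / 2 ^ n = real (2 ^ k) * (T / 2 ^ m)"
    by (simp add: m power_add)
  have cell: "0 < T / 2 ^ m"
    using T_pos by simp
  have dk: "2 ^ k \<le> d" "d \<le> 2 * 2 ^ k"
  proof -
    have "real (2 ^ k) * (T / 2 ^ m) \<le> real d * (T / 2 ^ m)"
      using n unfolding ts mesh .
    then have "real (2 ^ k) \<le> real d"
      using cell by (rule mult_right_le_imp_le)
    then show "2 ^ k \<le> d" by (simp only: of_nat_le_iff)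
    have "real d * (T / 2 ^ m) \<le> real (2 * 2 ^ k) * (T / 2 ^ m)"
      using n2 unfolding ts mesh by simp
    then have "real d \<le> real (2 * 2 ^ k)"
      using cell by (rule mult_right_le_imp_le)
    then show "d \<le> 2 * 2 ^ k" by (simp only: of_nat_le_iff)
  qed
  \<comment> \<open>p is i / \<open>2 ^ k\<close> rounded up, so that b is the first point of level n at or after s.\<close>
  define p where "p = (i + (2 ^ k - 1)) div 2 ^ k"
  define q where "q = p * 2 ^ k - i"
  have pq: "p * 2 ^ k = i + q" "q \<le> 2 ^ k" "q \<le> d"
  proof -
    have "i + (2 ^ k - 1) = p * 2 ^ k + (i + (2 ^ k - 1)) mod 2 ^ k"
      unfolding p_def by (rule div_mult_mod_eq[symmetric])
    moreover have "(i + (2 ^ k - 1)) mod 2 ^ k < 2 ^ k" "(1::nat) \<le> 2 ^ k"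
      by simp_all
    ultimately have "i \<le> p * 2 ^ k" "p * 2 ^ k \<le> i + (2 ^ k - 1)"
      by linarith+
    then show "p * 2 ^ k = i + q" "q \<le> 2 ^ k" "q \<le> d"
      using dk by (auto simp: q_def)
  qed
  define b where "b = dyad T n p"
  have b: "b = dyad T m (p * 2 ^ k)"
    unfolding b_def m by (rule dyad_refine[symmetric])
  have p: "p \<le> 2 ^ n"
  proof -
    have "p * 2 ^ k \<le> 2 ^ n * 2 ^ k"
      using pq j by (simp add: d m power_add)
    then show ?thesis by simp
  qed
  have bD: "b \<in> dyadics T"
    unfolding b_def using p by (rule dyad_in_dyadics)
  have sb: "s \<le> b" and bt: "b \<le> t"
    unfolding s t b using pq by (auto intro!: dyad_mono T_pos simp: d)
  define r where "r = d - q"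
  have jr: "j = p * 2 ^ k + r"
    using pq by (simp add: r_def d)
  have rate_le: "rate n \<le> (t - s) powr \<gamma>"
    unfolding rate_def using n T_pos \<gamma>_pos by (intro powr_mono2) auto
  have S0: "S 0 (R t' s') = R t' s'" if "s' \<in> dyadics T" "t' \<in> dyadics T" "s' \<le> t'" for s' t'
    using that by (simp add: residual_mem)
  have right: "nrm (R t b) \<le> W * rate n + (W + P) * (t - s) powr \<gamma>"
  proof (cases "r \<le> 2 ^ k")
    case True
    have "nrm (S 0 (R t b)) \<le> W * rate n"
      using chain_right[of r k p n 0] True j rng by (simp add: jr t b_def m)
    moreover have "0 \<le> (W + P) * (t - s) powr \<gamma>"
      using W_ge P(3) by simp
    ultimately show ?thesis
      using S0[OF bD D(2) bt] by simp
  next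
    case False
    define c where "c = dyad T n (Suc p)"
    have jr': "j = Suc p * 2 ^ k + (r - 2 ^ k)"
      using False by (simp add: jr)
    have "Suc p * 2 ^ k \<le> 2 ^ n * 2 ^ k"
      using j unfolding jr' by (simp add: m power_add)
    then have p': "Suc p \<le> 2 ^ n"
      by (simp only: mult_le_cancel2) simp
    have cD: "c \<in> dyadics T"
      unfolding c_def using p' by (rule dyad_in_dyadics)
    have bc: "b \<le> c"
      unfolding b_def c_def by (intro dyad_mono T_pos) simp
    have "c = dyad T m (Suc p * 2 ^ k)"
      unfolding c_def m by (rule dyad_refine[symmetric])
    then have ct: "c \<le> t"
      using dyad_mono[OF T_pos, of "Suc p * 2 ^ k" j m] jr' by (simp add: t)
    have "r - 2 ^ k \<le> 2 ^ k"
      using dk by (simp add: r_def)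
    then have "nrm (S 0 (R t c)) \<le> W * rate n"
      using chain_right[of "r - 2 ^ k" k "Suc p" n 0] j rng unfolding jr' t c_def m by simp
    moreover have "nrm (S (0 + (t - c)) (R c b)) \<le> M * (K * C_H) * rate n"
      unfolding c_def b_def
      by (intro shifted_level_bound) (use p' ct bc rng dyad_nonneg[OF T_pos, of n "Suc p"] in \<open>auto simp: c_def b_def\<close>)
    moreover have "nrm (S 0 (R t b)) \<le> nrm (S 0 (R t c)) + nrm (S (0 + (t - c)) (R c b)) + M * N * (t - s) powr \<gamma>"
      using bD cD D bc ct rng sb by (intro shifted_increment_bound) auto
    moreover have "M * (K * C_H) * rate n \<le> M * (K * C_H) * (t - s) powr \<gamma>"
      using rate_le M_ge_1 K_pos C_H_nonneg by (intro mult_left_mono) auto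
    moreover have "(M * N + M * (K * C_H)) * (t - s) powr \<gamma> = P * (t - s) powr \<gamma>"
      unfolding P(1) ..
    moreover have "0 \<le> W * (t - s) powr \<gamma>"
      using W_ge by simp
    ultimately show ?thesis
      using S0[OF bD D(2) bt] by (simp add: algebra_simps)
  qed
  have left: "nrm (S (0 + (t - b)) (R b s)) \<le> W * rate n"
    using chain_left[of q k p i n "t - b"] pq p bt rng by (simp add: s b_def m)
  have "nrm (S 0 (R t s)) \<le> nrm (S 0 (R t b)) + nrm (S (0 + (t - b)) (R b s)) + M * N * (t - s) powr \<gamma>"
    using bD D sb bt rng by (intro shifted_increment_bound) auto
  then have "nrm (R t s) \<le> nrm (R t b) + nrm (S (0 + (t - b)) (R b s)) + M * N * (t - s) powr \<gamma>"
    using S0 D bD st bt by simp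
  also have "\<dots> \<le> (W * rate n + (W + P) * (t - s) powr \<gamma>) + W * rate n + P * (t - s) powr \<gamma>"
    using P(2) by (intro add_mono right left mult_right_mono) auto
  also have "\<dots> \<le> (W * (t - s) powr \<gamma> + (W + W) * (t - s) powr \<gamma>) + W * (t - s) powr \<gamma> + W * (t - s) powr \<gamma>"
    using rate_le W_ge by (intro add_mono mult_left_mono mult_right_mono) auto
  also have "\<dots> = 5 * W * (t - s) powr \<gamma>"
    by (simp add: algebra_simps)
  finally show ?thesis .
qed

end


section \<open>Extension to the whole simplex\<close>

lemma dyadic_pair_approx:
  assumes "0 < T" "0 \<le> s" "s \<le> t" "t \<le> T"
  obtains p q :: "nat \<Rightarrow> real" where "\<And>n. p n \<in> dyadics T" "\<And>n. q n \<in> dyadics T"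
    "\<And>n. q n \<le> p n" "p \<longlonglongrightarrow> t" "q \<longlonglongrightarrow> s"
proof -
  have "t \<in> closure (dyadics T)" "s \<in> closure (dyadics T)"
    using dyadics_dense[OF assms(1)] assms by auto
  then obtain p q where pq: "\<And>n. p n \<in> dyadics T" "\<And>n. q n \<in> dyadics T" "p \<longlonglongrightarrow> t" "q \<longlonglongrightarrow> s"
    unfolding closure_sequential by blast
  show ?thesis
  proof (rule that)
    show "max (p n) (q n) \<in> dyadics T" "min (p n) (q n) \<in> dyadics T" for n
      using pq by (auto simp: max_def min_def)
    show "(\<lambda>n. max (p n) (q n)) \<longlonglongrightarrow> t" "(\<lambda>n. min (p n) (q n)) \<longlonglongrightarrow> s"
      using tendsto_max[OF pq(3,4)] tendsto_min[OF pq(3,4)] assms by (simp_all add: max_absorb1 min_absorb2)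
  qed auto
qed

context banach_on
begin

lemma cont_increments_eqI:
  assumes g: "g \<in> cont_increments T B nrm 2" "g' \<in> cont_increments T B nrm 2" and T: "0 < T"
    and eq: "\<And>t s. t \<in> dyadics T \<Longrightarrow> s \<in> dyadics T \<Longrightarrow> s \<le> t \<Longrightarrow> g [t, s] = g' [t, s]"
  shows "g = g'"
proof
  fix ts
  show "g ts = g' ts"
  proof (cases "ts \<in> simplex_T T 2")
    case True
    then obtain t s where ts: "ts = [t, s]" "0 \<le> s" "s \<le> t" "t \<le> T"
      by (rule simplex_T_2E)
    obtain p q where pq: "\<And>n. p n \<in> dyadics T" "\<And>n. q n \<in> dyadics T"
      "\<And>n. q n \<le> p n" "p \<longlonglongrightarrow> t" "q \<longlonglongrightarrow> s"
      using dyadic_pair_approx[OF T ts(2-4)] by metis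
    have mem: "[p n, q n] \<in> simplex_T T 2" for n
      using pq(1-3)[of n] dyadics_range[OF T] by simp
    have "(\<lambda>n. nrm (f [p n, q n] - f ts)) \<longlonglongrightarrow> 0" if "f \<in> cont_increments T B nrm 2" for f
      using pq(4,5) by (intro cont_increments_tendsto[OF that True] mem)
        (auto simp: ts less_Suc_eq numeral_2_eq_2)
    from tendsto_add[OF this[OF g(1)] this[OF g(2)]]
    have lim: "(\<lambda>n. nrm (g [p n, q n] - g ts) + nrm (g' [p n, q n] - g' ts)) \<longlonglongrightarrow> 0"
      by simp
    have gB: "g ts \<in> B" "g' ts \<in> B" "g [p n, q n] \<in> B" for n
      using g True mem by (auto intro: cont_increments_mem)
    have "nrm (g ts - g' ts) \<le> nrm (g [p n, q n] - g ts) + nrm (g' [p n, q n] - g' ts)" for n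
      using nrm_diff_triangle[OF gB(1,3,2)] nrm_diff_commute[OF gB(1,3)] eq[OF pq(1-3)] by metis
    then have "nrm (g ts - g' ts) \<le> 0"
      using LIMSEQ_le_const[OF lim] by blast
    then show ?thesis
      using gB by (intro eqI_nrm) auto
  next
    case False
    then show ?thesis
      using g by (simp add: cont_increments_def)
  qed
qed

end

locale continuous_recursion = admissible_recursion B nrm S T \<gamma> H sp \<theta> C_H M
  for B :: "'a::real_vector set" and nrm S T \<gamma> H sp \<theta> C_H M +
  assumes continuity: "residual_continuity T nrm S sp H"
begin

lemma residual_continuityE:
  assumes "e > 0"
  obtains \<eta> where "\<eta> > 0" "\<And>h t s. 0 < h \<Longrightarrow> h < \<eta> \<Longrightarrow> t \<in> dyadics T \<Longrightarrow> s \<in> dyadics T \<Longrightarrow> s \<le> t \<Longrightarrow>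
    t + h \<le> T \<Longrightarrow> nrm (S h (R t s) - R t s) < e"
proof -
  let ?D = "\<lambda>h. {(t, s). t \<in> dyadics T \<and> s \<in> dyadics T \<and> s \<le> t \<and> t + h \<le> T}"
  let ?F = "\<lambda>h. SUP (t, s)\<in>?D h. ennreal (nrm (S h (R t s) - R t s))"
  have "\<forall>\<^sub>F h in at_right 0. ?F h < ennreal e"
    using continuity assms unfolding residual_continuity_def by (intro order_tendstoD(2)) auto
  then obtain \<eta> where \<eta>: "\<eta> > 0" "\<And>h. 0 < h \<Longrightarrow> h < \<eta> \<Longrightarrow> ?F h < ennreal e"
    unfolding eventually_at_right_field by blast
  show ?thesis
  proof (rule that[OF \<eta>(1)])
    fix h t s assume h: "0 < h" "h < \<eta>" and ts: "t \<in> dyadics T" "s \<in> dyadics T" "s \<le> t" "t + h \<le> T"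
    have "ennreal (nrm (S h (R t s) - R t s)) \<le> ?F h"
      using ts by (intro SUP_upper2[of "(t, s)"]) auto
    also have "\<dots> < ennreal e"
      using \<eta>(2)[OF h] .
    finally show "nrm (S h (R t s) - R t s) < e"
      using ts h by (simp add: ennreal_less_iff residual_mem)
  qed
qed

text \<open>
  Since \<open>I t = - R t 0\<close>, the increment of the path between p < q is the residual on [p, q], which is
  small by the Hoelder bound, plus \<open>(S (q - p) - Id) (R p 0)\<close>, which the residual continuity
  criterion controls, plus \<open>H [q, p, 0]\<close>, which is small because H vanishes where its first two
  arguments agree.
\<close>

lemma path_locally_Cauchy:
  assumes t: "t \<in> {0..T}" and e: "e > 0"
  shows "\<exists>d>0. \<forall>p\<in>dyadics T. \<forall>q\<in>dyadics T. \<bar>p - t\<bar> < d \<longrightarrow> \<bar>q - t\<bar> < d \<longrightarrow> nrm (I p - I q) < e"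
proof -
  define c where "c = e / (3 * (5 * W + 1))"
  have c: "c > 0" "5 * W * c < e / 3"
    using e W_ge by (simp_all add: c_def field_simps)
  define d1 where "d1 = c powr (1 / \<gamma>)"
  have d1: "d1 > 0" "d1 powr \<gamma> = c"
    using c \<gamma>_pos by (simp_all add: d1_def powr_powr)
  have tt: "[t, t, 0] \<in> simplex_T T 3" and Htt: "H [t, t, 0] = 0"
    using t by (auto intro: H_diag)
  have "\<exists>d>0. \<forall>us\<in>simplex_T T 3. (\<forall>i<3. \<bar>us ! i - [t, t, 0] ! i\<bar> < d) \<longrightarrow> nrm (H us - H [t, t, 0]) < e / 3"
    using e by (intro cont_incrementsD[OF H_cont tt]) simp
  then obtain d2 where d2: "d2 > 0"
    "\<And>us. us \<in> simplex_T T 3 \<Longrightarrow> (\<forall>i<3. \<bar>us ! i - [t, t, 0] ! i\<bar> < d2) \<Longrightarrow> nrm (H us) < e / 3"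
    unfolding Htt by auto
  obtain \<eta> where \<eta>: "\<eta> > 0" "\<And>h t s. 0 < h \<Longrightarrow> h < \<eta> \<Longrightarrow> t \<in> dyadics T \<Longrightarrow> s \<in> dyadics T \<Longrightarrow> s \<le> t \<Longrightarrow>
    t + h \<le> T \<Longrightarrow> nrm (S h (R t s) - R t s) < e / 3"
    using residual_continuityE[of "e / 3"] e by auto
  \<comment> \<open>Two points closer than d to t are less than 2 * d apart.\<close>
  define d where "d = min (d1 / 2) (min d2 (\<eta> / 2))"
  have d: "d > 0" "d \<le> d1 / 2" "d \<le> d2" "d \<le> \<eta> / 2"
    using d1 d2 \<eta> by (auto simp: d_def)
  have close: "nrm (I p - I q) < e"
    if D: "p \<in> dyadics T" "q \<in> dyadics T" and near: "\<bar>p - t\<bar> < d" "\<bar>q - t\<bar> < d" and pq: "p < q" for p q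
  proof -
    have rng: "0 \<le> p" "q \<le> T"
      using D dyadics_range[OF T_pos] by auto
    have root: "I x = - R x 0" if "x \<in> dyadics T" for x
      using that dyadics_range[OF T_pos] by (simp add: residual_def germ_0 path_0)
    have mem: "R q p \<in> B" "R p 0 \<in> B" "H [q, p, 0] \<in> B" "S (q - p) (R p 0) \<in> B"
      using D pq rng by (auto intro!: residual_mem H_mem S_mem dyadics_0)
    have "I p - I q = R q p + (S (q - p) (R p 0) - R p 0) + H [q, p, 0]"
      using residual_increment[OF dyadics_0 D] pq rng by (simp add: root D)
    then have "nrm (I p - I q) \<le> nrm (R q p) + nrm (S (q - p) (R p 0) - R p 0) + nrm (H [q, p, 0])"
      using nrm_triangle[of "R q p" "S (q - p) (R p 0) - R p 0"]
        nrm_triangle[of "R q p + (S (q - p) (R p 0) - R p 0)" "H [q, p, 0]"] mem by simp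
    moreover have "nrm (R q p) < e / 3"
    proof -
      have "nrm (R q p) \<le> 5 * W * (q - p) powr \<gamma>"
        using dyadic_holder_bound[OF D pq] .
      also have "\<dots> \<le> 5 * W * d1 powr \<gamma>"
        using near d pq W_ge \<gamma>_pos by (intro mult_left_mono powr_mono2) auto
      finally show ?thesis using c d1 by simp
    qed
    moreover have "nrm (S (q - p) (R p 0) - R p 0) < e / 3"
      using near d pq rng D dyadics_0 by (intro \<eta>(2)) auto
    moreover have "nrm (H [q, p, 0]) < e / 3"
      using near d pq rng d2(1) by (intro d2(2)) (auto simp: all_less_3)
    ultimately show ?thesis by linarith
  qed
  have "nrm (I p - I q) < e"
    if "p \<in> dyadics T" "q \<in> dyadics T" "\<bar>p - t\<bar> < d" "\<bar>q - t\<bar> < d" for p q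
    using close[of p q] close[of q p] that nrm_diff_commute[OF path_mem path_mem, of p q] e
    by (cases p q rule: linorder_cases) auto
  then show ?thesis
    using d(1) by blast
qed

text \<open>
  Only the path has to be extended. The germ is already defined everywhere, and the reduced
  increment of a remainder built from any path is H.
\<close>

lemma extension_exists:
  obtains g where "extends_residual T B nrm S sp H g" "\<And>ts. ts \<in> simplex_T T 3 \<Longrightarrow> hat_delta S g ts = H ts"
proof -
  have "dyadics T \<subseteq> {0..T}"
    using dyadics_range[OF T_pos] by auto
  from extend_from_dense[OF dyadics_dense[OF T_pos] this path_mem path_locally_Cauchy]
  obtain J where J: "\<And>t. t \<in> {0..T} \<Longrightarrow> J t \<in> B" "\<And>p. p \<in> dyadics T \<Longrightarrow> J p = I p"
    "\<And>t e. t \<in> {0..T} \<Longrightarrow> e > 0 \<Longrightarrow> \<exists>d>0. \<forall>u\<in>{0..T}. \<bar>u - t\<bar> < d \<longrightarrow> nrm (J u - J t) < e"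
    by metis
  define G where "G t s = germ H t s - J t + S (t - s) (J s)" for t s
  define g where "g ts = (if ts \<in> simplex_T T 2 then G (ts ! 0) (ts ! 1) else 0)" for ts
  have g: "g [t, s] = G t s" if "0 \<le> s" "s \<le> t" "t \<le> T" for t s
    using that by (simp add: g_def)
  have cont: "\<exists>d>0. \<forall>us\<in>simplex_T T 2. (\<forall>i<2. \<bar>us ! i - ts ! i\<bar> < d) \<longrightarrow> nrm (g us - g ts) < e"
    if tsS: "ts \<in> simplex_T T 2" and e: "e > 0" for ts e
  proof -
    obtain t s where ts: "ts = [t, s]" "0 \<le> s" "s \<le> t" "t \<le> T"
      using tsS by (rule simplex_T_2E)
    have "\<exists>d>0. \<forall>us\<in>simplex_T T 3. (\<forall>i<3. \<bar>us ! i - [t, s, 0] ! i\<bar> < d) \<longrightarrow> nrm (H us - H [t, s, 0]) < e / 4"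
      using ts e by (intro cont_incrementsD[OF H_cont]) auto
    then obtain d1 where d1: "d1 > 0" "\<And>us. us \<in> simplex_T T 3 \<Longrightarrow>
        (\<forall>i<3. \<bar>us ! i - [t, s, 0] ! i\<bar> < d1) \<Longrightarrow> nrm (H us - H [t, s, 0]) < e / 4"
      by blast
    obtain d2 where d2: "d2 > 0" "\<And>u. u \<in> {0..T} \<Longrightarrow> \<bar>u - t\<bar> < d2 \<Longrightarrow> nrm (J u - J t) < e / 4"
      using J(3)[of t "e / 4"] ts e by auto
    obtain d3 where d3: "d3 > 0" "\<And>u. u \<in> {0..T} \<Longrightarrow> \<bar>u - s\<bar> < d3 \<Longrightarrow> nrm (J u - J s) < e / (4 * M)"
      using J(3)[of s "e / (4 * M)"] ts e M_ge_1 by auto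
    obtain d4 where d4: "d4 > 0"
      "\<And>r. 0 \<le> r \<Longrightarrow> \<bar>r - (t - s)\<bar> < d4 \<Longrightarrow> nrm (S r (J s) - S (t - s) (J s)) < e / 4"
      using S_continuous[of "J s" "t - s" "e / 4"] J(1) ts e by auto
    define d where "d = min (min d1 d2) (min d3 (d4 / 2))"
    have d: "d > 0" "d \<le> d1" "d \<le> d2" "d \<le> d3" "d \<le> d4 / 2"
      using d1 d2 d3 d4 by (auto simp: d_def)
    have "nrm (g us - g ts) < e"
      if us: "us \<in> simplex_T T 2" and near: "\<forall>i<2. \<bar>us ! i - ts ! i\<bar> < d" for us
    proof -
      obtain t' s' where us': "us = [t', s']" "0 \<le> s'" "s' \<le> t'" "t' \<le> T"
        using us by (rule simplex_T_2E)
      have near': "\<bar>t' - t\<bar> < d" "\<bar>s' - s\<bar> < d"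
        using near by (auto simp: us' ts all_less_2)
      let ?a = "H [t, s, 0] - H [t', s', 0]" and ?b = "J t - J t'"
        and ?c = "S (t' - s') (J s' - J s)" and ?d = "S (t' - s') (J s) - S (t - s) (J s)"
      have Jm: "J t \<in> B" "J t' \<in> B" "J s \<in> B" "J s' \<in> B"
        using J(1) ts us' by auto
      have mem: "?a \<in> B" "?b \<in> B" "?c \<in> B" "?d \<in> B"
        using Jm ts us' by (auto intro!: diff_mem H_mem S_mem)
      have "g us - g ts = ?a + ?b + (?c + ?d)"
        using ts us' Jm by (simp add: g G_def germ_def S_diff)
      then have "nrm (g us - g ts) \<le> nrm ?a + nrm ?b + (nrm ?c + nrm ?d)"
        using nrm_triangle[of "?a + ?b" "?c + ?d"] nrm_triangle[of ?a ?b] nrm_triangle[of ?c ?d] mem by simp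
      moreover have "nrm ?a < e / 4"
      proof -
        have "nrm (H [t', s', 0] - H [t, s, 0]) < e / 4"
          using us' near' d by (intro d1(2)) (auto simp: all_less_3)
        then show ?thesis
          using nrm_diff_commute[OF H_mem H_mem, of 0 s t 0 s' t'] ts us' by simp
      qed
      moreover have "nrm ?b < e / 4"
        using d2(2)[of t'] near' d us' nrm_diff_commute[OF Jm(1,2)] by simp
      moreover have "nrm ?c < e / 4"
      proof -
        have "nrm ?c \<le> M * nrm (J s' - J s)"
          using Jm us' by (intro S_bound) auto
        also have "\<dots> < M * (e / (4 * M))"
          using d3(2)[of s'] near' d us' M_ge_1 by (intro mult_strict_left_mono) auto
        finally show ?thesis using M_ge_1 by simp
      qed
      moreover have "nrm ?d < e / 4"
        using near' d us' by (intro d4(2)) auto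
      ultimately show ?thesis by linarith
    qed
    then show ?thesis using d(1) by blast
  qed
  have "g \<in> cont_increments T B nrm 2"
    unfolding cont_increments_def mem_Collect_eq
  proof (intro conjI ballI allI impI)
    fix ts assume "ts \<in> simplex_T T 2"
    then show "g ts \<in> B"
      using J(1) by (elim simplex_T_2E) (auto simp: g G_def germ_mem)
  next
    fix ts and e :: real assume "ts \<in> simplex_T T 2" "0 < e"
    then show "\<exists>d>0. \<forall>us\<in>simplex_T T 2. (\<forall>i<2. \<bar>us ! i - ts ! i\<bar> < d) \<longrightarrow> nrm (g us - g ts) < e"
      by (rule cont)
  qed (simp add: g_def)
  moreover have "g [t, s] = R t s" if "t \<in> dyadics T" "s \<in> dyadics T" "s \<le> t" for t s
    using that dyadics_range[OF T_pos] by (simp add: g G_def J(2) residual_def)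
  ultimately have "extends_residual T B nrm S sp H g"
    by (auto simp: extends_residual_def)
  moreover have "hat_delta S g ts = H ts" if tsS: "ts \<in> simplex_T T 3" for ts
  proof -
    obtain t u s where ts: "ts = [t, u, s]" "0 \<le> s" "s \<le> u" "u \<le> t" "t \<le> T"
      using tsS by (rule simplex_T_3E)
    have "G t s = G t u + S (t - u) (G u s) + H [t, u, s]"
      unfolding G_def using ts J(1) by (intro remainder_increment) auto
    then show ?thesis
      using ts by (simp add: hat_delta_2 g)
  qed
  ultimately show ?thesis
    using that by blast
qed

lemma extension_unique:
  "extends_residual T B nrm S sp H g \<Longrightarrow> extends_residual T B nrm S sp H g' \<Longrightarrow> g = g'"
  by (rule cont_increments_eqI[OF _ _ T_pos]) (auto simp: extends_residual_def)

lemma ex1_extension: "\<exists>!g. extends_residual T B nrm S sp H g"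
  using extension_exists extension_unique by metis

lemma hat_Lambda_extends: "extends_residual T B nrm S sp H (hat_Lambda T B nrm S sp H)"
  unfolding hat_Lambda_def by (rule theI'[OF ex1_extension])

lemma hat_Lambda_eqI: "extends_residual T B nrm S sp H g \<Longrightarrow> hat_Lambda T B nrm S sp H = g"
  using extension_unique[OF hat_Lambda_extends] .

lemma hat_delta_hat_Lambda:
  assumes "ts \<in> simplex_T T 3"
  shows "hat_delta S (hat_Lambda T B nrm S sp H) ts = H ts"
  using extension_exists hat_Lambda_eqI assms by metis

lemma extension_bound:
  assumes g: "extends_residual T B nrm S sp H g" and ord: "0 \<le> s" "s < t" "t \<le> T"
  shows "nrm (g [t, s]) \<le> 5 * W * (t - s) powr \<gamma>"
proof -
  have gc: "g \<in> cont_increments T B nrm 2"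
    using g by (simp add: extends_residual_def)
  obtain p q where pq: "\<And>n. p n \<in> dyadics T" "\<And>n. q n \<in> dyadics T"
    "\<And>n. q n \<le> p n" "p \<longlonglongrightarrow> t" "q \<longlonglongrightarrow> s"
    using dyadic_pair_approx[OF T_pos ord(1) less_imp_le[OF ord(2)] ord(3)] by metis
  have mem: "[t, s] \<in> simplex_T T 2" "[p n, q n] \<in> simplex_T T 2" for n
    using ord pq(1-3)[of n] dyadics_range[OF T_pos] by auto
  have "(\<lambda>n. nrm (g [p n, q n] - g [t, s])) \<longlonglongrightarrow> 0"
    using pq(4,5) by (intro cont_increments_tendsto[OF gc] mem) (auto simp: less_Suc_eq numeral_2_eq_2)
  then have "(\<lambda>n. nrm (g [p n, q n])) \<longlonglongrightarrow> nrm (g [t, s])"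
    by (intro tendsto_nrm cont_increments_mem[OF gc] mem)
  moreover have "(\<lambda>n. 5 * W * (p n - q n) powr \<gamma>) \<longlonglongrightarrow> 5 * W * (t - s) powr \<gamma>"
    using pq(4,5) ord by (intro tendsto_intros) auto
  moreover have "nrm (g [p n, q n]) \<le> 5 * W * (p n - q n) powr \<gamma>" for n
  proof (cases "p n = q n")
    case True
    then show ?thesis
      using g pq(2) by (simp add: extends_residual_def residual_diag)
  next
    case False
    then show ?thesis
      using g pq(1-3)[of n] dyadic_holder_bound[of "q n" "p n"] by (simp add: extends_residual_def)
  qed
  ultimately show ?thesis
    by (intro LIMSEQ_le) auto
qed

lemma hat_Lambda_enorm2: "enorm2 T nrm \<gamma> (hat_Lambda T B nrm S sp H) \<le> ennreal (5 * W)"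
  unfolding enorm2_def
proof (rule SUP_least, clarify)
  fix t s :: real assume "0 \<le> s" "s < t" "t \<le> T"
  then show "ennreal (nrm (hat_Lambda T B nrm S sp H [t, s]) / \<bar>t - s\<bar> powr \<gamma>) \<le> ennreal (5 * W)"
    using extension_bound[OF hat_Lambda_extends, of s t] by (intro ennreal_leI) (simp add: field_simps)
qed

lemma hat_Lambda_holder2: "hat_Lambda T B nrm S sp H \<in> holder2 T B nrm \<gamma>"
  using hat_Lambda_extends hat_Lambda_enorm2 order_le_less_trans[OF _ ennreal_less_top]
  by (auto simp: holder2_def extends_residual_def)

lemma hat_Lambda_norm2: "norm2 T nrm \<gamma> (hat_Lambda T B nrm S sp H) \<le> 5 * W"
  unfolding norm2_def using hat_Lambda_enorm2 W_ge by (intro enn2real_leI) auto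

end

text \<open>
  The factor in front of \<open>N + C_H\<close> when the constants K, P and W are substituted into \<open>5 * W\<close>. The
  maximum with 1 makes it positive whatever \<open>\<theta>\<close> is.
\<close>

definition sewing_constant :: "real \<Rightarrow> real \<Rightarrow> real \<Rightarrow> real" where
  "sewing_constant M \<gamma> \<theta> =
     max 1 (5 * M * (1 / (2 powr (- \<gamma>) - \<theta>) + 1) / (1 - 2 powr (- \<gamma>)))"

lemma sewing_constant_pos: "0 < sewing_constant M \<gamma> \<theta>"
  by (simp add: sewing_constant_def)

lemma (in admissible_recursion) W_le: "5 * W \<le> sewing_constant M \<gamma> \<theta> * (N + C_H)"
proof -
  have r: "0 < 1 - 2 powr (- \<gamma>)"
    using ratio(2) by linarith
  have "K * C_H + N \<le> (K + 1) * (N + C_H)"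
    using K_pos C_H_nonneg N_nonneg mult_nonneg_nonneg[of K N] by (simp add: algebra_simps)
  then have "P \<le> M * ((K + 1) * (N + C_H))"
    unfolding P_def using M_ge_1 by (intro mult_left_mono) auto
  then have "5 * W \<le> 5 * (M * ((K + 1) * (N + C_H)) / (1 - 2 powr (- \<gamma>)))"
    unfolding W_def using r by (intro mult_left_mono divide_right_mono) auto
  also have "\<dots> = (5 * M * (1 / (2 powr (- \<gamma>) - \<theta>) + 1) / (1 - 2 powr (- \<gamma>))) * (N + C_H)"
    by (simp add: K_def)
  also have "\<dots> \<le> sewing_constant M \<gamma> \<theta> * (N + C_H)"
    unfolding sewing_constant_def using C_H_nonneg N_nonneg by (intro mult_right_mono) auto
  finally show ?thesis .
qed

lemma (in continuous_recursion) hat_Lambda_norm2_le: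
  "norm2 T nrm \<gamma> (hat_Lambda T B nrm S sp H) \<le> sewing_constant M \<gamma> \<theta> * (N + C_H)"
  using hat_Lambda_norm2 W_le by linarith


section \<open>Linearity\<close>

lemma germ_lin: "germ (\<lambda>ts. x *\<^sub>R H ts + y *\<^sub>R K ts) t s = x *\<^sub>R germ H t s + y *\<^sub>R germ K t s"
  by (simp add: germ_def)

lemma (in banach_on) cont_increments_lin:
  assumes g: "g \<in> cont_increments T B nrm n" and h: "h \<in> cont_increments T B nrm n"
  shows "(\<lambda>ts. x *\<^sub>R g ts + y *\<^sub>R h ts) \<in> cont_increments T B nrm n"
  unfolding cont_increments_def mem_Collect_eq
proof (intro conjI ballI allI impI)
  fix ts assume "ts \<in> simplex_T T n"
  then show "x *\<^sub>R g ts + y *\<^sub>R h ts \<in> B"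
    by (intro add_mem scale_mem cont_increments_mem[OF g] cont_increments_mem[OF h])
next
  fix ts and e :: real assume ts: "ts \<in> simplex_T T n" and e: "0 < e"
  define k where "k = \<bar>x\<bar> + \<bar>y\<bar> + 1"
  define c where "c = e / (2 * k)"
  have k: "k > 0" "\<bar>x\<bar> + \<bar>y\<bar> \<le> k"
    by (simp_all add: k_def add_pos_nonneg)
  have c: "c > 0" "k * c < e"
    using e k by (simp_all add: c_def)
  then have ce: "(\<bar>x\<bar> + \<bar>y\<bar>) * c < e"
    using mult_right_mono[OF k(2), of c] by linarith
  obtain d1 where d1: "d1 > 0" "\<And>us. us \<in> simplex_T T n \<Longrightarrow> (\<forall>i<n. \<bar>us ! i - ts ! i\<bar> < d1) \<Longrightarrow> nrm (g us - g ts) < c"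
    using cont_incrementsD[OF g ts c(1)] by blast
  obtain d2 where d2: "d2 > 0" "\<And>us. us \<in> simplex_T T n \<Longrightarrow> (\<forall>i<n. \<bar>us ! i - ts ! i\<bar> < d2) \<Longrightarrow> nrm (h us - h ts) < c"
    using cont_incrementsD[OF h ts c(1)] by blast
  have "nrm (x *\<^sub>R g us + y *\<^sub>R h us - (x *\<^sub>R g ts + y *\<^sub>R h ts)) < e"
    if us: "us \<in> simplex_T T n" "\<forall>i<n. \<bar>us ! i - ts ! i\<bar> < min d1 d2" for us
  proof -
    have mem: "g us - g ts \<in> B" "h us - h ts \<in> B"
      using us ts by (auto intro!: diff_mem cont_increments_mem[OF g] cont_increments_mem[OF h])
    have "x *\<^sub>R g us + y *\<^sub>R h us - (x *\<^sub>R g ts + y *\<^sub>R h ts) = x *\<^sub>R (g us - g ts) + y *\<^sub>R (h us - h ts)"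
      by (simp add: algebra_simps)
    then have "nrm (x *\<^sub>R g us + y *\<^sub>R h us - (x *\<^sub>R g ts + y *\<^sub>R h ts))
        \<le> \<bar>x\<bar> * nrm (g us - g ts) + \<bar>y\<bar> * nrm (h us - h ts)"
      using nrm_triangle[OF scale_mem[OF mem(1)] scale_mem[OF mem(2)], of x y] nrm_scale mem by simp
    also have "\<dots> \<le> \<bar>x\<bar> * c + \<bar>y\<bar> * c"
      using d1(2)[of us] d2(2)[of us] us by (intro add_mono mult_left_mono) auto
    also have "\<dots> < e"
      using ce by (simp add: distrib_right)
    finally show ?thesis .
  qed
  then show "\<exists>d>0. \<forall>us\<in>simplex_T T n. (\<forall>i<n. \<bar>us ! i - ts ! i\<bar> < d) \<longrightarrow>
      nrm (x *\<^sub>R g us + y *\<^sub>R h us - (x *\<^sub>R g ts + y *\<^sub>R h ts)) < e"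
    using d1(1) d2(1) by (intro exI[of _ "min d1 d2"]) auto
qed (use g h in \<open>auto simp: cont_increments_def\<close>)

text \<open>
  Linearity of the rule concerns residuals on dyadic intervals only. Solved for the path value at
  the right end point, \<open>I c = germ H c a + S (c - a) (I a) - R c a\<close>, such a residual carries
  linearity of the path from one grid point of a level to the next.
\<close>

lemma path_linear:
  assumes H: "dyadic_recursion B nrm S T \<gamma> H sp" and K: "dyadic_recursion B nrm S T \<gamma> K sp'"
    and L: "dyadic_recursion B nrm S T \<gamma> (\<lambda>ts. x *\<^sub>R H ts + y *\<^sub>R K ts) sp''"
    and lin: "\<And>a c. (a, c) \<in> dyadic_intervals T \<Longrightarrow>
      residual S T sp'' (\<lambda>ts. x *\<^sub>R H ts + y *\<^sub>R K ts) c a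
        = x *\<^sub>R residual S T sp H c a + y *\<^sub>R residual S T sp' K c a"
    and t: "t \<in> dyadics T"
  shows "dyadic_path S T sp'' (\<lambda>ts. x *\<^sub>R H ts + y *\<^sub>R K ts) t
    = x *\<^sub>R dyadic_path S T sp H t + y *\<^sub>R dyadic_path S T sp' K t"
proof -
  interpret H: dyadic_recursion B nrm S T \<gamma> H sp by fact
  interpret K: dyadic_recursion B nrm S T \<gamma> K sp' by fact
  interpret L: dyadic_recursion B nrm S T \<gamma> "\<lambda>ts. x *\<^sub>R H ts + y *\<^sub>R K ts" sp'' by fact
  have "L.I (dyad T n k) = x *\<^sub>R H.I (dyad T n k) + y *\<^sub>R K.I (dyad T n k)" if "k \<le> 2 ^ n" for n k
    using that
  proof (induction k)
    case 0
    then show ?case by (simp add: H.path_0 K.path_0 L.path_0)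
  next
    case (Suc k)
    let ?a = "dyad T n k" and ?c = "dyad T n (Suc k)"
    have ac: "(?a, ?c) \<in> dyadic_intervals T"
      unfolding dyadic_intervals_iff using Suc.prems by (intro exI[of _ n] exI[of _ k]) auto
    have D: "?a \<in> dyadics T"
      using Suc.prems by (intro dyad_in_dyadics) simp
    have "S (?c - ?a) (x *\<^sub>R H.I ?a + y *\<^sub>R K.I ?a) = x *\<^sub>R S (?c - ?a) (H.I ?a) + y *\<^sub>R S (?c - ?a) (K.I ?a)"
      using H.T_pos by (intro H.S_lin H.path_mem[OF D] K.path_mem[OF D]) simp
    then have "S (?c - ?a) (L.I ?a) = x *\<^sub>R S (?c - ?a) (H.I ?a) + y *\<^sub>R S (?c - ?a) (K.I ?a)"
      using Suc by simp
    then show ?case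
      using lin[OF ac] unfolding residual_def germ_lin by (simp add: algebra_simps)
  qed
  then show ?thesis
    using t by (auto simp: dyadics_def dyadic_level_iff)
qed

lemma hat_Lambda_linear:
  assumes H: "continuous_recursion B nrm S T \<gamma> H sp \<theta> C_H M"
    and K: "continuous_recursion B nrm S T \<gamma> K sp' \<theta>' C_K M'"
    and L: "continuous_recursion B nrm S T \<gamma> (\<lambda>ts. x *\<^sub>R H ts + y *\<^sub>R K ts) sp'' \<theta>'' C_L M''"
    and lin: "\<And>a c. (a, c) \<in> dyadic_intervals T \<Longrightarrow>
      residual S T sp'' (\<lambda>ts. x *\<^sub>R H ts + y *\<^sub>R K ts) c a
        = x *\<^sub>R residual S T sp H c a + y *\<^sub>R residual S T sp' K c a"
  shows "hat_Lambda T B nrm S sp'' (\<lambda>ts. x *\<^sub>R H ts + y *\<^sub>R K ts)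
    = (\<lambda>ts. x *\<^sub>R hat_Lambda T B nrm S sp H ts + y *\<^sub>R hat_Lambda T B nrm S sp' K ts)"
proof -
  interpret H: continuous_recursion B nrm S T \<gamma> H sp \<theta> C_H M by fact
  interpret K: continuous_recursion B nrm S T \<gamma> K sp' \<theta>' C_K M' by fact
  interpret L: continuous_recursion B nrm S T \<gamma> "\<lambda>ts. x *\<^sub>R H ts + y *\<^sub>R K ts" sp'' \<theta>'' C_L M'' by fact
  have path: "L.I t = x *\<^sub>R H.I t + y *\<^sub>R K.I t" if "t \<in> dyadics T" for t
    using H.dyadic_recursion_axioms K.dyadic_recursion_axioms L.dyadic_recursion_axioms lin that
    by (rule path_linear)
  have "L.R t s = x *\<^sub>R H.R t s + y *\<^sub>R K.R t s" if "t \<in> dyadics T" "s \<in> dyadics T" "s \<le> t" for t s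
    using that H.S_lin[of "t - s" "H.I s" "K.I s" x y]
    by (simp add: residual_def germ_lin path H.path_mem K.path_mem algebra_simps)
  then show ?thesis
    using H.hat_Lambda_extends K.hat_Lambda_extends
    by (intro L.hat_Lambda_eqI) (auto simp: extends_residual_def intro!: H.cont_increments_lin)
qed


section \<open>The sewing map\<close>

theorem theorem6p6:
  fixes T \<gamma> \<alpha> :: real
    and B :: "real \<Rightarrow> 'a::real_vector set"
    and nrm :: "real \<Rightarrow> 'a \<Rightarrow> real"
    and S :: "real \<Rightarrow> 'a \<Rightarrow> 'a"
  assumes "0 < T"
    and "banach_scale B nrm"
    and "analytic_semigroup_on_scale T B nrm S"
    and "0 < \<gamma>" and "\<gamma> < 1"
  shows
    "(\<forall>\<theta> C_s \<sigma>. \<exists>C>0. \<forall>D.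
        selection_domain T (B \<alpha>) (nrm \<alpha>) S \<gamma> \<theta> C_s \<sigma> D \<longrightarrow>
        (let \<Lambda> = (\<lambda>H. hat_Lambda T (B \<alpha>) (nrm \<alpha>) S (\<sigma> H) H) in
          (\<forall>H\<in>D. \<exists>!g. extends_residual T (B \<alpha>) (nrm \<alpha>) S (\<sigma> H) H g) \<and>
          (\<forall>H\<in>D. \<Lambda> H \<in> holder2 T (B \<alpha>) (nrm \<alpha>) \<gamma>) \<and>
          (\<forall>H\<in>D. \<forall>K\<in>D. \<forall>x y.
             \<Lambda> (\<lambda>ts. x *\<^sub>R H ts + y *\<^sub>R K ts) = (\<lambda>ts. x *\<^sub>R \<Lambda> H ts + y *\<^sub>R \<Lambda> K ts)) \<and>
          (\<forall>H\<in>D. \<forall>e>0. \<exists>d>0. \<forall>K\<in>D.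
             norm3 T (B \<alpha>) (nrm \<alpha>) \<gamma> (\<lambda>ts. K ts - H ts) < d \<longrightarrow>
             norm2 T (nrm \<alpha>) \<gamma> (\<lambda>ts. \<Lambda> K ts - \<Lambda> H ts) < e) \<and>
          (\<forall>H\<in>D. \<forall>ts\<in>simplex_T T 3. hat_delta S (\<Lambda> H) ts = H ts) \<and>
          (\<forall>H\<in>D. norm2 T (nrm \<alpha>) \<gamma> (\<Lambda> H) \<le> C * norm3 T (B \<alpha>) (nrm \<alpha>) \<gamma> H)))
     \<and>
     (\<forall>\<theta>. \<exists>C>0. \<forall>H sp C_H.
        H \<in> Z_holder3 T (B \<alpha>) (nrm \<alpha>) S \<gamma> \<longrightarrow>
        splitting_rule T (B \<alpha>) S sp H \<longrightarrow>
        subcritical_admissible T (nrm \<alpha>) S \<gamma> \<theta> C_H sp H \<longrightarrow>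
        residual_continuity T (nrm \<alpha>) S sp H \<longrightarrow>
        (let g = hat_Lambda T (B \<alpha>) (nrm \<alpha>) S sp H in
          (\<exists>!g'. extends_residual T (B \<alpha>) (nrm \<alpha>) S sp H g') \<and>
          g \<in> holder2 T (B \<alpha>) (nrm \<alpha>) \<gamma> \<and>
          (\<forall>ts\<in>simplex_T T 3. hat_delta S g ts = H ts) \<and>
          norm2 T (nrm \<alpha>) \<gamma> g \<le> C * (norm3 T (B \<alpha>) (nrm \<alpha>) \<gamma> H + C_H)))"
proof -
  have "analytic_semigroup_on (B \<alpha>) (nrm \<alpha>) S" "banach_space_on (B \<alpha>) (nrm \<alpha>)"
    using assms(2,3) by (auto simp: analytic_semigroup_on_scale_def banach_scale_def)
  then interpret semigroup_on "B \<alpha>" "nrm \<alpha>" S T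
    using assms(1) by unfold_locales (auto simp: analytic_semigroup_on_def)
  obtain M where M: "M \<ge> 1" "\<forall>t\<in>{0..T}. \<forall>x\<in>B \<alpha>. nrm \<alpha> (S t x) \<le> M * nrm \<alpha> x"
    using S_uniformly_bounded by blast
  let ?N = "norm3 T (B \<alpha>) (nrm \<alpha>) \<gamma>"
  have recursion: "continuous_recursion (B \<alpha>) (nrm \<alpha>) S T \<gamma> H sp \<theta> C_H M"
    if "H \<in> Z_holder3 T (B \<alpha>) (nrm \<alpha>) S \<gamma>" "splitting_rule T (B \<alpha>) S sp H"
      "subcritical_admissible T (nrm \<alpha>) S \<gamma> \<theta> C_H sp H" "residual_continuity T (nrm \<alpha>) S sp H"
    for H sp \<theta> C_H
    using that M assms(4) by unfold_locales auto
  show ?thesis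
  proof (intro conjI allI)
    fix \<theta>
    show "\<exists>C>0. \<forall>H sp C_H.
        H \<in> Z_holder3 T (B \<alpha>) (nrm \<alpha>) S \<gamma> \<longrightarrow>
        splitting_rule T (B \<alpha>) S sp H \<longrightarrow>
        subcritical_admissible T (nrm \<alpha>) S \<gamma> \<theta> C_H sp H \<longrightarrow>
        residual_continuity T (nrm \<alpha>) S sp H \<longrightarrow>
        (let g = hat_Lambda T (B \<alpha>) (nrm \<alpha>) S sp H in
          (\<exists>!g'. extends_residual T (B \<alpha>) (nrm \<alpha>) S sp H g') \<and>
          g \<in> holder2 T (B \<alpha>) (nrm \<alpha>) \<gamma> \<and>
          (\<forall>ts\<in>simplex_T T 3. hat_delta S g ts = H ts) \<and>
          norm2 T (nrm \<alpha>) \<gamma> g \<le> C * (norm3 T (B \<alpha>) (nrm \<alpha>) \<gamma> H + C_H))"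
    proof (intro exI[of _ "sewing_constant M \<gamma> \<theta>"] conjI allI impI)
      fix H sp C_H
      assume "H \<in> Z_holder3 T (B \<alpha>) (nrm \<alpha>) S \<gamma>" "splitting_rule T (B \<alpha>) S sp H"
        "subcritical_admissible T (nrm \<alpha>) S \<gamma> \<theta> C_H sp H" "residual_continuity T (nrm \<alpha>) S sp H"
      then interpret r: continuous_recursion "B \<alpha>" "nrm \<alpha>" S T \<gamma> H sp \<theta> C_H M
        by (rule recursion)
      show "let g = hat_Lambda T (B \<alpha>) (nrm \<alpha>) S sp H in
          (\<exists>!g'. extends_residual T (B \<alpha>) (nrm \<alpha>) S sp H g') \<and>
          g \<in> holder2 T (B \<alpha>) (nrm \<alpha>) \<gamma> \<and>
          (\<forall>ts\<in>simplex_T T 3. hat_delta S g ts = H ts) \<and>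
          norm2 T (nrm \<alpha>) \<gamma> g \<le> sewing_constant M \<gamma> \<theta> * (norm3 T (B \<alpha>) (nrm \<alpha>) \<gamma> H + C_H)"
        unfolding Let_def
        using r.ex1_extension r.hat_Lambda_holder2 r.hat_delta_hat_Lambda r.hat_Lambda_norm2_le by blast
    qed (rule sewing_constant_pos)
  next
    fix \<theta> C_s \<sigma>
    \<comment> \<open>In a selection domain the constant of the rule is at most \<open>C_s\<close> times the norm of H.\<close>
    define C where "C = sewing_constant M \<gamma> \<theta> * (1 + \<bar>C_s\<bar>)"
    have C: "C > 0"
      using sewing_constant_pos by (simp add: C_def add_pos_nonneg)
    let ?\<Lambda> = "\<lambda>H. hat_Lambda T (B \<alpha>) (nrm \<alpha>) S (\<sigma> H) H"
    show "\<exists>C>0. \<forall>D. selection_domain T (B \<alpha>) (nrm \<alpha>) S \<gamma> \<theta> C_s \<sigma> D \<longrightarrow>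
        (let \<Lambda> = ?\<Lambda> in
          (\<forall>H\<in>D. \<exists>!g. extends_residual T (B \<alpha>) (nrm \<alpha>) S (\<sigma> H) H g) \<and>
          (\<forall>H\<in>D. \<Lambda> H \<in> holder2 T (B \<alpha>) (nrm \<alpha>) \<gamma>) \<and>
          (\<forall>H\<in>D. \<forall>K\<in>D. \<forall>x y.
             \<Lambda> (\<lambda>ts. x *\<^sub>R H ts + y *\<^sub>R K ts) = (\<lambda>ts. x *\<^sub>R \<Lambda> H ts + y *\<^sub>R \<Lambda> K ts)) \<and>
          (\<forall>H\<in>D. \<forall>e>0. \<exists>d>0. \<forall>K\<in>D.
             norm3 T (B \<alpha>) (nrm \<alpha>) \<gamma> (\<lambda>ts. K ts - H ts) < d \<longrightarrow>
             norm2 T (nrm \<alpha>) \<gamma> (\<lambda>ts. \<Lambda> K ts - \<Lambda> H ts) < e) \<and>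
          (\<forall>H\<in>D. \<forall>ts\<in>simplex_T T 3. hat_delta S (\<Lambda> H) ts = H ts) \<and>
          (\<forall>H\<in>D. norm2 T (nrm \<alpha>) \<gamma> (\<Lambda> H) \<le> C * norm3 T (B \<alpha>) (nrm \<alpha>) \<gamma> H))"
    proof (intro exI[of _ C] conjI allI impI C)
      fix D assume dom: "selection_domain T (B \<alpha>) (nrm \<alpha>) S \<gamma> \<theta> C_s \<sigma> D"
      have sub: "H \<in> Z_holder3 T (B \<alpha>) (nrm \<alpha>) S \<gamma>"
        and split: "splitting_rule T (B \<alpha>) S (\<sigma> H) H"
        and adm: "\<exists>C_H. C_H \<le> C_s * ?N H \<and> subcritical_admissible T (nrm \<alpha>) S \<gamma> \<theta> C_H (\<sigma> H) H"
        and cont: "residual_continuity T (nrm \<alpha>) S (\<sigma> H) H" if "H \<in> D" for H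
        using dom that unfolding selection_domain_def by blast+
      have comb: "(\<lambda>ts. x *\<^sub>R H ts + y *\<^sub>R K ts) \<in> D" if "H \<in> D" "K \<in> D" for H K x y
        using dom that unfolding selection_domain_def by blast
      have res_lin: "residual S T (\<sigma> (\<lambda>ts. x *\<^sub>R H ts + y *\<^sub>R K ts)) (\<lambda>ts. x *\<^sub>R H ts + y *\<^sub>R K ts) c a
          = x *\<^sub>R residual S T (\<sigma> H) H c a + y *\<^sub>R residual S T (\<sigma> K) K c a"
        if "H \<in> D" "K \<in> D" "(a, c) \<in> dyadic_intervals T" for H K x y a c
      proof -
        have "\<forall>(a, c)\<in>dyadic_intervals T.
            residual S T (\<sigma> (\<lambda>ts. x *\<^sub>R H ts + y *\<^sub>R K ts)) (\<lambda>ts. x *\<^sub>R H ts + y *\<^sub>R K ts) c a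
              = x *\<^sub>R residual S T (\<sigma> H) H c a + y *\<^sub>R residual S T (\<sigma> K) K c a"
          using dom that(1,2) unfolding selection_domain_def by (elim conjE) blast
        from bspec[OF this that(3)] show ?thesis
          by simp
      qed
      have rec: "\<exists>C_H. C_H \<le> C_s * ?N H \<and>
          continuous_recursion (B \<alpha>) (nrm \<alpha>) S T \<gamma> H (\<sigma> H) \<theta> C_H M" if "H \<in> D" for H
        using adm[OF that] recursion[OF sub[OF that] split[OF that] _ cont[OF that]] by blast
      have ext: "\<exists>!g. extends_residual T (B \<alpha>) (nrm \<alpha>) S (\<sigma> H) H g"
        and hold: "?\<Lambda> H \<in> holder2 T (B \<alpha>) (nrm \<alpha>) \<gamma>"
        and delta: "ts \<in> simplex_T T 3 \<Longrightarrow> hat_delta S (?\<Lambda> H) ts = H ts"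
        and bound: "norm2 T (nrm \<alpha>) \<gamma> (?\<Lambda> H) \<le> C * ?N H" if H: "H \<in> D" for H ts
      proof -
        obtain C_H where C_H: "C_H \<le> C_s * ?N H"
          and "continuous_recursion (B \<alpha>) (nrm \<alpha>) S T \<gamma> H (\<sigma> H) \<theta> C_H M"
          using rec[OF H] by blast
        then interpret r: continuous_recursion "B \<alpha>" "nrm \<alpha>" S T \<gamma> H "\<sigma> H" \<theta> C_H M
          by blast
        show "\<exists>!g. extends_residual T (B \<alpha>) (nrm \<alpha>) S (\<sigma> H) H g" "?\<Lambda> H \<in> holder2 T (B \<alpha>) (nrm \<alpha>) \<gamma>"
          "ts \<in> simplex_T T 3 \<Longrightarrow> hat_delta S (?\<Lambda> H) ts = H ts"
          by (fact r.ex1_extension r.hat_Lambda_holder2 r.hat_delta_hat_Lambda)+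
        have "C_s * ?N H \<le> \<bar>C_s\<bar> * ?N H"
          by (intro mult_right_mono) auto
        then have "?N H + C_H \<le> (1 + \<bar>C_s\<bar>) * ?N H"
          using C_H by (simp add: distrib_right)
        then have "sewing_constant M \<gamma> \<theta> * (?N H + C_H) \<le> C * ?N H"
          unfolding C_def mult.assoc using sewing_constant_pos by (intro mult_left_mono) (auto intro: less_imp_le)
        then show "norm2 T (nrm \<alpha>) \<gamma> (?\<Lambda> H) \<le> C * ?N H"
          using r.hat_Lambda_norm2_le by linarith
      qed
      have linear: "?\<Lambda> (\<lambda>ts. x *\<^sub>R H ts + y *\<^sub>R K ts) = (\<lambda>ts. x *\<^sub>R ?\<Lambda> H ts + y *\<^sub>R ?\<Lambda> K ts)"
        if HK: "H \<in> D" "K \<in> D" for H K x y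
      proof -
        obtain C_H C_K C_L where "continuous_recursion (B \<alpha>) (nrm \<alpha>) S T \<gamma> H (\<sigma> H) \<theta> C_H M"
          "continuous_recursion (B \<alpha>) (nrm \<alpha>) S T \<gamma> K (\<sigma> K) \<theta> C_K M"
          "continuous_recursion (B \<alpha>) (nrm \<alpha>) S T \<gamma> (\<lambda>ts. x *\<^sub>R H ts + y *\<^sub>R K ts)
             (\<sigma> (\<lambda>ts. x *\<^sub>R H ts + y *\<^sub>R K ts)) \<theta> C_L M"
          using rec[OF HK(1)] rec[OF HK(2)] rec[OF comb[OF HK, of x y]] by blast
        then show ?thesis
          using res_lin[OF HK] by (rule hat_Lambda_linear)
      qed
      have continuous: "\<exists>d>0. \<forall>K\<in>D. ?N (\<lambda>ts. K ts - H ts) < d \<longrightarrow>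
          norm2 T (nrm \<alpha>) \<gamma> (\<lambda>ts. ?\<Lambda> K ts - ?\<Lambda> H ts) < e" if H: "H \<in> D" and e: "e > 0" for H e
      proof (intro exI[of _ "e / C"] conjI ballI impI)
        fix K assume K: "K \<in> D" and small: "?N (\<lambda>ts. K ts - H ts) < e / C"
        have "(\<lambda>ts. K ts - H ts) \<in> D"
          using comb[OF K H, of 1 "-1"] by simp
        then have "norm2 T (nrm \<alpha>) \<gamma> (?\<Lambda> (\<lambda>ts. K ts - H ts)) \<le> C * ?N (\<lambda>ts. K ts - H ts)"
          by (rule bound)
        also have "\<dots> < e"
          using small C by (simp add: field_simps)
        finally show "norm2 T (nrm \<alpha>) \<gamma> (\<lambda>ts. ?\<Lambda> K ts - ?\<Lambda> H ts) < e"
          using linear[OF K H, of 1 "-1"] by simp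
      qed (use C e in simp)
      show "let \<Lambda> = ?\<Lambda> in
          (\<forall>H\<in>D. \<exists>!g. extends_residual T (B \<alpha>) (nrm \<alpha>) S (\<sigma> H) H g) \<and>
          (\<forall>H\<in>D. \<Lambda> H \<in> holder2 T (B \<alpha>) (nrm \<alpha>) \<gamma>) \<and>
          (\<forall>H\<in>D. \<forall>K\<in>D. \<forall>x y.
             \<Lambda> (\<lambda>ts. x *\<^sub>R H ts + y *\<^sub>R K ts) = (\<lambda>ts. x *\<^sub>R \<Lambda> H ts + y *\<^sub>R \<Lambda> K ts)) \<and>
          (\<forall>H\<in>D. \<forall>e>0. \<exists>d>0. \<forall>K\<in>D.
             norm3 T (B \<alpha>) (nrm \<alpha>) \<gamma> (\<lambda>ts. K ts - H ts) < d \<longrightarrow>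
             norm2 T (nrm \<alpha>) \<gamma> (\<lambda>ts. \<Lambda> K ts - \<Lambda> H ts) < e) \<and>
          (\<forall>H\<in>D. \<forall>ts\<in>simplex_T T 3. hat_delta S (\<Lambda> H) ts = H ts) \<and>
          (\<forall>H\<in>D. norm2 T (nrm \<alpha>) \<gamma> (\<Lambda> H) \<le> C * norm3 T (B \<alpha>) (nrm \<alpha>) \<gamma> H)"
        unfolding Let_def by (intro conjI ballI allI impI ext hold delta bound linear continuous)
    qed
  qed
qed

end
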